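(* Let $1\le p<\infty$ and let $(X,\mathcal B,\mu,f,T_f)$ be a dissipative composition dynamical system of bounded distortion generated by $W$, with $T_f:L^p(X)\to L^p(X)$, $T_f(\varphi)=\varphi\circ f$. Let $B_w:\ell^p(\mathbb Z)\to\ell^p(\mathbb Z)$ be the bilateral weighted backward shift with weights \[ w_k=\left(\frac{\mu(f^{k-1}(W))}{\mu(f^{k}(W))}\right)^{\frac1p},\qquad k\in\mathbb Z. \] Then $T_f$ is $\mathbb C$-supercyclic if and only if $B_w$ is $\mathbb C$-supercyclic.
   Context: Setting: $X$ is a locally compact, $\sigma$-compact, second countable Hausdorff space, $\mathcal B$ is the Borel $\sigma$-algebra of $X$, and $\mu$ is a locally finite Borel measure on $X$ (hence $\sigma$-finite). The map $f:X\to X$ is bijective and bimeasurable (both $f$ and $f^{-1}$ are measurable), and the Radon-Nikodym derivatives of $\mu\circ f$ and of $\mu\circ f^{-1}$ with respect to $\mu$ exist and are bounded from below (by a positive constant). Then $T_f(\varphi)=\varphi\circ f$ is a well-defined bounded invertible linear operator on the space $L^p(X)=L^p(X,\mathcal B,\mu)$ of complex-valued functions, called a composition operator, and $(X,\mathcal B,\mu,f,T_f)$ is called a composition dynamical system. The system is dissipative, generated by $W$, if $W\in\mathcal B$, $0<\mu(W)<\infty$, and $X=\bigcup_{k\in\mathbb Z}f^k(W)$ with the sets $f^k(W)$, $k\in\mathbb Z$, pairwise disjoint. It is of bounded distortion if, in addition, there is $K>0$ such that \[ \frac1K\,\mu(f^k(W))\,\mu(B)\le \mu(f^k(B))\,\mu(W)\le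 K\,\mu(f^k(W))\,\mu(B) \] for all $k\in\mathbb Z$ and all measurable $B\subseteq W$ with $\mu(B)>0$. Given a bounded sequence $\{w_i\}_{i\in\mathbb Z}$, the bilateral weighted backward shift $B_w$ on the complex space $\ell^p(\mathbb Z)$ is defined by $(B_w x)(i)=w_{i+1}x_{i+1}$, $i\in\mathbb Z$. A bounded linear operator $T$ on a separable complex Banach space $E$ is $\mathbb C$-supercyclic if there is $x\in E$ such that $\{\lambda T^n x: n\ge 0,\ \lambda\in\mathbb C\}$ is dense in $E$. *)

theory Defs
  imports "HOL-Analysis.Analysis"
begin

section \<open>The spaces \<open>L\<^sup>p\<close> and \<open>\<ell>\<^sup>p(\<int>)\<close>\<close>

definition Lp_functions :: "real \<Rightarrow> 'a measure \<Rightarrow> ('a \<Rightarrow> complex) set" where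
  "Lp_functions p M = {f \<in> borel_measurable M. integrable M (\<lambda>x. norm (f x) powr p)}"

definition Lp_norm :: "real \<Rightarrow> 'a measure \<Rightarrow> ('a \<Rightarrow> complex) \<Rightarrow> real" where
  "Lp_norm p M f = (\<integral>x. norm (f x) powr p \<partial>M) powr (1 / p)"

definition Lp_rel :: "real \<Rightarrow> 'a measure \<Rightarrow> (('a \<Rightarrow> complex) \<times> ('a \<Rightarrow> complex)) set" where
  "Lp_rel p M = {(f, g). f \<in> Lp_functions p M \<and> g \<in> Lp_functions p M \<and> (AE x in M. f x = g x)}"

definition Lp_space :: "real \<Rightarrow> 'a measure \<Rightarrow> ('a \<Rightarrow> complex) set set" where
  "Lp_space p M = Lp_functions p M // Lp_rel p M"

text \<open>The value does not depend on the chosen representatives, see \<open>Lp_dist_class\<close> below.\<close>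

definition Lp_dist :: "real \<Rightarrow> 'a measure \<Rightarrow> ('a \<Rightarrow> complex) set \<Rightarrow> ('a \<Rightarrow> complex) set \<Rightarrow> real" where
  "Lp_dist p M F G = Lp_norm p M (\<lambda>x. (SOME f. f \<in> F) x - (SOME g. g \<in> G) x)"

definition Lp_scale ::
  "real \<Rightarrow> 'a measure \<Rightarrow> complex \<Rightarrow> ('a \<Rightarrow> complex) set \<Rightarrow> ('a \<Rightarrow> complex) set" where
  "Lp_scale p M c F = (\<Union>\<phi>\<in>F. Lp_rel p M `` {\<lambda>x. c * \<phi> x})"

definition lp_space :: "real \<Rightarrow> (int \<Rightarrow> complex) set" where
  "lp_space p = {x. (\<lambda>i. norm (x i) powr p) summable_on UNIV}"

definition lp_dist :: "real \<Rightarrow> (int \<Rightarrow> complex) \<Rightarrow> (int \<Rightarrow> complex) \<Rightarrow> real" where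
  "lp_dist p x y = (\<Sum>\<^sub>\<infinity>i. norm (x i - y i) powr p) powr (1 / p)"

definition lp_scale :: "complex \<Rightarrow> (int \<Rightarrow> complex) \<Rightarrow> int \<Rightarrow> complex" where
  "lp_scale c x = (\<lambda>i. c * x i)"


section \<open>Supercyclicity and the two operators\<close>

text \<open>The space is given by its carrier \<open>E\<close>, its norm distance \<open>d\<close> and its scalar
  multiplication. Density is closure in the metric topology; the lemmas \<open>Metric_space_Lp\<close> and
  \<open>Metric_space_lp\<close> below show that the two instances used are metric spaces.\<close>

definition supercyclic ::
  "'e set \<Rightarrow> ('e \<Rightarrow> 'e \<Rightarrow> real) \<Rightarrow> (complex \<Rightarrow> 'e \<Rightarrow> 'e) \<Rightarrow> ('e \<Rightarrow> 'e) \<Rightarrow> bool" where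
  "supercyclic E d sm T \<longleftrightarrow>
     (\<exists>x\<in>E. Metric_space.mtopology E d closure_of {sm c ((T ^^ n) x) | (n::nat) c. True} = E)"

definition composition_operator ::
  "real \<Rightarrow> 'a measure \<Rightarrow> ('a \<Rightarrow> 'a) \<Rightarrow> ('a \<Rightarrow> complex) set \<Rightarrow> ('a \<Rightarrow> complex) set" where
  "composition_operator p M f F = (\<Union>\<phi>\<in>F. Lp_rel p M `` {\<phi> \<circ> f})"

definition weighted_shift :: "(int \<Rightarrow> complex) \<Rightarrow> (int \<Rightarrow> complex) \<Rightarrow> int \<Rightarrow> complex" where
  "weighted_shift w x = (\<lambda>i. w (i + 1) * x (i + 1))"


section \<open>Composition dynamical systems\<close>

definition int_iterate :: "('a \<Rightarrow> 'a) \<Rightarrow> int \<Rightarrow> 'a \<Rightarrow> 'a" where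
  "int_iterate f k = (if 0 \<le> k then f ^^ nat k else inv f ^^ nat (- k))"

definition RN_deriv_bounded_below :: "'a measure \<Rightarrow> 'a measure \<Rightarrow> bool" where
  "RN_deriv_bounded_below M N \<longleftrightarrow>
     (\<exists>h \<in> borel_measurable M. density M h = N) \<and>
     (\<exists>c::real. c > 0 \<and> (AE x in M. ennreal c \<le> RN_deriv M N x))"

text \<open>For a bimeasurable bijection \<open>f\<close>, the measure \<open>\<mu> \<circ> f\<close>, i.e. \<open>B \<mapsto> \<mu>(f(B))\<close>, is the
  push-forward of \<open>\<mu>\<close> under \<open>f\<^sup>-\<^sup>1\<close>, and \<open>\<mu> \<circ> f\<^sup>-\<^sup>1\<close> is the push-forward under \<open>f\<close>.\<close>

locale composition_system =
  fixes M :: "'a::{second_countable_topology, t2_space} measure" and f :: "'a \<Rightarrow> 'a"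
  assumes locally_compact: "locally_compact_space (euclidean :: 'a topology)"
    and sigma_compact: "\<exists>K :: nat \<Rightarrow> 'a set. (\<forall>n. compact (K n)) \<and> (\<Union>n. K n) = UNIV"
    and sets_borel: "sets M = sets borel"
    and locally_finite: "\<And>x. \<exists>U. open U \<and> x \<in> U \<and> emeasure M U < \<infinity>"
    and bij: "bij f"
    and measurable_f: "f \<in> measurable M M"
    and measurable_inv_f: "inv f \<in> measurable M M"
    and RN_f: "RN_deriv_bounded_below M (distr M M (inv f))"
    and RN_inv_f: "RN_deriv_bounded_below M (distr M M f)"

locale dissipative_system = composition_system M f
  for M :: "'a::{second_countable_topology, t2_space} measure" and f :: "'a \<Rightarrow> 'a" +
  fixes W :: "'a set"
  assumes W_sets: "W \<in> sets M"
    and W_pos: "0 < emeasure M W"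
    and W_finite: "emeasure M W < \<infinity>"
    and W_cover: "(\<Union>k. int_iterate f k ` W) = UNIV"
    and W_disjoint: "disjoint_family (\<lambda>k. int_iterate f k ` W)"

locale bounded_distortion_system = dissipative_system M f W
  for M :: "'a::{second_countable_topology, t2_space} measure" and f :: "'a \<Rightarrow> 'a" and W :: "'a set" +
  assumes distortion:
    "\<exists>K::real. K > 0 \<and>
       (\<forall>k. \<forall>B\<in>sets M. B \<subseteq> W \<longrightarrow> emeasure M B > 0 \<longrightarrow>
          ennreal (1 / K) * emeasure M (int_iterate f k ` W) * emeasure M B
            \<le> emeasure M (int_iterate f k ` B) * emeasure M W \<and>
          emeasure M (int_iterate f k ` B) * emeasure M W
            \<le> ennreal K * emeasure M (int_iterate f k ` W) * emeasure M B)"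


section \<open>The definitions are well behaved\<close>

lemma powr_convex_combination:
  fixes a b t p :: real
  assumes "1 \<le> p" "0 \<le> a" "0 \<le> b" "0 \<le> t" "t \<le> 1"
  shows "((1 - t) * a + t * b) powr p \<le> (1 - t) * a powr p + t * b powr p"
proof -
  have scale: "(s * c) powr p \<le> s * c powr p" if "0 \<le> s" "s \<le> 1" "0 \<le> c" for s c :: real
  proof (cases "s = 0")
    case False
    with that assms have "s powr p \<le> s powr 1"
      by (intro powr_mono') auto
    then show ?thesis
      using that by (auto simp: powr_mult intro!: mult_right_mono)
  qed (use assms in auto)
  consider "a = 0" | "b = 0" | "a > 0" "b > 0"
    using assms by linarith
  then show ?thesis
  proof cases
    case 3
    then show ?thesis
      using convex_onD[OF powr_convex[OF assms(1)], of t a b] assms by simp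
  qed (use scale[of t b] scale[of "1 - t" a] assms in auto)
qed

lemma Lp_norm_nonneg [simp]: "0 \<le> Lp_norm p M f"
  by (simp add: Lp_norm_def)

lemma Lp_norm_powr:
  assumes "1 \<le> p"
  shows "Lp_norm p M f powr p = (\<integral>x. norm (f x) powr p \<partial>M)"
  using assms by (simp add: Lp_norm_def powr_powr integral_nonneg_AE)

lemma Lp_norm_cong_AE:
  assumes "f \<in> borel_measurable M" "g \<in> borel_measurable M" "AE x in M. f x = g x"
  shows "Lp_norm p M f = Lp_norm p M g"
proof -
  have "(\<integral>x. norm (f x) powr p \<partial>M) = (\<integral>x. norm (g x) powr p \<partial>M)"
    using assms by (intro integral_cong_AE) auto
  then show ?thesis
    by (simp add: Lp_norm_def)
qed

lemma Lp_norm_eq_0_iff: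
  assumes "1 \<le> p" "f \<in> Lp_functions p M"
  shows "Lp_norm p M f = 0 \<longleftrightarrow> (AE x in M. f x = 0)"
proof -
  have "Lp_norm p M f = 0 \<longleftrightarrow> (\<integral>x. norm (f x) powr p \<partial>M) = 0"
    using assms by (simp add: Lp_norm_def)
  also have "\<dots> \<longleftrightarrow> (AE x in M. norm (f x) powr p = 0)"
    using assms by (intro integral_nonneg_eq_0_iff_AE) (auto simp: Lp_functions_def)
  finally show ?thesis
    using assms by simp
qed

lemma Lp_Minkowski:
  assumes p: "1 \<le> p" and f: "f \<in> Lp_functions p M" and g: "g \<in> Lp_functions p M"
  shows "(\<lambda>x. f x + g x) \<in> Lp_functions p M"
    and "Lp_norm p M (\<lambda>x. f x + g x) \<le> Lp_norm p M f + Lp_norm p M g"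
proof -
  have [measurable]: "f \<in> borel_measurable M" "g \<in> borel_measurable M"
    and int: "integrable M (\<lambda>x. norm (f x) powr p)" "integrable M (\<lambda>x. norm (g x) powr p)"
    using f g by (auto simp: Lp_functions_def)
  have bound: "norm (f x + g x) powr p
      \<le> (A + B) powr p * (A / (A + B) * (norm (f x) / A) powr p + B / (A + B) * (norm (g x) / B) powr p)"
    if "A > 0" "B > 0" for A B :: real and x
  proof -
    define t where "t = B / (A + B)"
    have t: "0 \<le> t" "t \<le> 1" "1 - t = A / (A + B)"
      using that by (auto simp: t_def field_simps)
    have eq: "norm (f x) + norm (g x) = (A + B) * ((1 - t) * (norm (f x) / A) + t * (norm (g x) / B))"
    proof -
      have "(A + B) * (1 - t) = A" "(A + B) * t = B"
        using that add_pos_pos[OF that] unfolding t(3) unfolding t_def by auto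
      then have *: "(A + B) * ((1 - t) * u + t * v) = A * u + B * v" for u v
        by (metis distrib_left mult.assoc)
      show ?thesis
        unfolding * using that by simp
    qed
    have "norm (f x + g x) powr p \<le> (norm (f x) + norm (g x)) powr p"
      using p by (intro powr_mono2) (auto simp: norm_triangle_ineq)
    also have "\<dots> = (A + B) powr p * ((1 - t) * (norm (f x) / A) + t * (norm (g x) / B)) powr p"
      unfolding eq using that t by (subst powr_mult) auto
    also have "\<dots> \<le> (A + B) powr p * ((1 - t) * (norm (f x) / A) powr p + t * (norm (g x) / B) powr p)"
      using that t p by (intro mult_left_mono powr_convex_combination) auto
    finally show ?thesis
      unfolding t(3) by (simp add: t_def)
  qed
  have intb: "integrable M (\<lambda>x. (A + B) powr p *
      (A / (A + B) * (norm (f x) / A) powr p + B / (A + B) * (norm (g x) / B) powr p))"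
    if "A > 0" "B > 0" for A B :: real
    using that int by (simp add: powr_divide)
  have sum_int: "integrable M (\<lambda>x. norm (f x + g x) powr p)"
    by (rule Bochner_Integration.integrable_bound[OF intb[of 1 1]])
       (use bound[of 1 1] in \<open>auto intro!: AE_I2 elim!: order_trans\<close>)
  then show "(\<lambda>x. f x + g x) \<in> Lp_functions p M"
    by (simp add: Lp_functions_def)
  define A B where "A = Lp_norm p M f" and "B = Lp_norm p M g"
  have AB: "0 \<le> A" "0 \<le> B"
    by (auto simp: A_def B_def)
  consider "A = 0" | "B = 0" | "A > 0" "B > 0"
    using AB by linarith
  then have "Lp_norm p M (\<lambda>x. f x + g x) \<le> A + B"
  proof cases
    case 1
    then have "AE x in M. f x + g x = g x"
      using Lp_norm_eq_0_iff[OF p f] by (auto simp: A_def)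
    from Lp_norm_cong_AE[OF _ _ this, of p] AB show ?thesis
      by (simp add: B_def)
  next
    case 2
    then have "AE x in M. f x + g x = f x"
      using Lp_norm_eq_0_iff[OF p g] by (auto simp: B_def)
    from Lp_norm_cong_AE[OF _ _ this, of p] AB show ?thesis
      by (simp add: A_def)
  next
    case 3
    have A: "A powr p = (\<integral>x. norm (f x) powr p \<partial>M)" and B: "B powr p = (\<integral>x. norm (g x) powr p \<partial>M)"
      by (simp_all add: A_def B_def Lp_norm_powr[OF p])
    have "(\<integral>x. norm (f x + g x) powr p \<partial>M) \<le>
        (\<integral>x. (A + B) powr p *
          (A / (A + B) * (norm (f x) / A) powr p + B / (A + B) * (norm (g x) / B) powr p) \<partial>M)"
      using bound[OF 3] by (intro integral_mono sum_int intb 3)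
    also have "\<dots> = (A + B) powr p * (A / (A + B) * (A powr p / A powr p) + B / (A + B) * (B powr p / B powr p))"
      using 3 int by (simp add: powr_divide A[symmetric] B[symmetric])
    also have "\<dots> = (A + B) powr p"
      using 3 by (simp add: add_divide_distrib[symmetric])
    finally have "Lp_norm p M (\<lambda>x. f x + g x) \<le> ((A + B) powr p) powr (1 / p)"
      unfolding Lp_norm_def using p by (intro powr_mono2) auto
    then show ?thesis
      using 3 p by (simp add: powr_powr)
  qed
  then show "Lp_norm p M (\<lambda>x. f x + g x) \<le> Lp_norm p M f + Lp_norm p M g"
    by (simp add: A_def B_def)
qed

lemma Lp_functions_scale:
  assumes "f \<in> Lp_functions p M"
  shows "(\<lambda>x. c * f x) \<in> Lp_functions p M"
  using assms by (auto simp: Lp_functions_def norm_mult powr_mult)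

lemma Lp_functions_diff:
  assumes "1 \<le> p" "f \<in> Lp_functions p M" "g \<in> Lp_functions p M"
  shows "(\<lambda>x. f x - g x) \<in> Lp_functions p M"
  using Lp_Minkowski(1)[OF assms(1,2) Lp_functions_scale[OF assms(3), of "-1"]] by simp

lemma equiv_Lp_rel: "equiv (Lp_functions p M) (Lp_rel p M)"
proof (rule equivI)
  show "Lp_rel p M \<subseteq> Lp_functions p M \<times> Lp_functions p M"
    by (auto simp: Lp_rel_def)
  show "refl_on (Lp_functions p M) (Lp_rel p M)"
    by (auto simp: Lp_rel_def refl_on_def)
  show "sym (Lp_rel p M)"
    by (auto simp: Lp_rel_def sym_def)
  show "trans (Lp_rel p M)"
    by (rule transI) (auto simp: Lp_rel_def)
qed

lemma Lp_space_some:
  assumes "F \<in> Lp_space p M"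
  shows "(SOME f. f \<in> F) \<in> F" "(SOME f. f \<in> F) \<in> Lp_functions p M"
proof -
  have "F \<noteq> {}" "F \<subseteq> Lp_functions p M"
    using assms in_quotient_imp_non_empty[OF equiv_Lp_rel] in_quotient_imp_subset[OF equiv_Lp_rel]
    unfolding Lp_space_def by metis+
  then show "(SOME f. f \<in> F) \<in> F" "(SOME f. f \<in> F) \<in> Lp_functions p M"
    using some_in_eq[of F] by blast+
qed

lemma Lp_dist_class:
  assumes F: "F \<in> Lp_space p M" "f \<in> F" and G: "G \<in> Lp_space p M" "g \<in> G"
  shows "Lp_dist p M F G = Lp_norm p M (\<lambda>x. f x - g x)"
proof -
  have "(SOME f. f \<in> F, f) \<in> Lp_rel p M" "(SOME g. g \<in> G, g) \<in> Lp_rel p M"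
    using quotient_eq_iff[OF equiv_Lp_rel] F G Lp_space_some(1)[OF F(1)] Lp_space_some(1)[OF G(1)]
    unfolding Lp_space_def by metis+
  then show ?thesis
    unfolding Lp_dist_def
    by (intro Lp_norm_cong_AE) (auto simp: Lp_rel_def Lp_functions_def)
qed

lemma Metric_space_Lp:
  assumes p: "1 \<le> p"
  shows "Metric_space (Lp_space p M) (Lp_dist p M)"
proof
  fix F G H :: "('a \<Rightarrow> complex) set"
  show "0 \<le> Lp_dist p M F G"
    by (simp add: Lp_dist_def)
  show "Lp_dist p M F G = Lp_dist p M G F"
    by (simp add: Lp_dist_def Lp_norm_def norm_minus_commute)
  assume F: "F \<in> Lp_space p M" and G: "G \<in> Lp_space p M"
  let ?f = "SOME f. f \<in> F" and ?g = "SOME f. f \<in> G" and ?h = "SOME f. f \<in> H"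
  note FG = Lp_space_some[OF F] Lp_space_some[OF G]
  have "Lp_dist p M F G = 0 \<longleftrightarrow> (AE x in M. ?f x - ?g x = 0)"
    unfolding Lp_dist_def using FG by (intro Lp_norm_eq_0_iff p Lp_functions_diff)
  also have "\<dots> \<longleftrightarrow> (?f, ?g) \<in> Lp_rel p M"
    using FG by (simp add: Lp_rel_def)
  also have "\<dots> \<longleftrightarrow> F = G"
    using quotient_eq_iff[OF equiv_Lp_rel] F G FG unfolding Lp_space_def by metis
  finally show "Lp_dist p M F G = 0 \<longleftrightarrow> F = G" .
  assume H: "H \<in> Lp_space p M"
  have "Lp_norm p M (\<lambda>x. (?f x - ?g x) + (?g x - ?h x))
      \<le> Lp_norm p M (\<lambda>x. ?f x - ?g x) + Lp_norm p M (\<lambda>x. ?g x - ?h x)"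
    using FG Lp_space_some[OF H] by (intro Lp_Minkowski p Lp_functions_diff)
  then show "Lp_dist p M F H \<le> Lp_dist p M F G + Lp_dist p M G H"
    by (simp add: Lp_dist_def)
qed

lemma lp_space_eq: "lp_space p = Lp_functions p (count_space UNIV)"
proof -
  have "integrable (count_space UNIV) (\<lambda>i. norm (x i) powr p) \<longleftrightarrow>
      (\<lambda>i. norm (x i) powr p) summable_on UNIV" for x :: "int \<Rightarrow> complex"
    using abs_summable_equivalent[of "\<lambda>i. norm (x i) powr p" UNIV]
    by (simp add: abs_summable_on_def)
  then show ?thesis
    by (simp add: lp_space_def Lp_functions_def)
qed

lemma lp_dist_eq:
  assumes "1 \<le> p" "x \<in> lp_space p" "y \<in> lp_space p"
  shows "lp_dist p x y = Lp_norm p (count_space UNIV) (\<lambda>i. x i - y i)"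
proof -
  have "(\<lambda>i. x i - y i) \<in> Lp_functions p (count_space UNIV)"
    using assms Lp_functions_diff by (simp add: lp_space_eq)
  then have "(\<Sum>\<^sub>\<infinity>i. norm (x i - y i) powr p) = (\<Sum>\<^sub>ai. norm (x i - y i) powr p)"
    by (intro infsetsum_infsum[symmetric]) (simp add: Lp_functions_def abs_summable_on_def)
  then show ?thesis
    by (simp add: lp_dist_def Lp_norm_def infsetsum_def)
qed

lemma Metric_space_lp:
  assumes p: "1 \<le> p"
  shows "Metric_space (lp_space p) (lp_dist p)"
proof
  fix x y z
  show "0 \<le> lp_dist p x y"
    by (simp add: lp_dist_def)
  show "lp_dist p x y = lp_dist p y x"
    by (simp add: lp_dist_def norm_minus_commute)
  assume x: "x \<in> lp_space p" and y: "y \<in> lp_space p"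
  have "lp_dist p x y = 0 \<longleftrightarrow> (AE i in count_space UNIV. x i - y i = 0)"
    unfolding lp_dist_eq[OF p x y]
    using x y by (intro Lp_norm_eq_0_iff p Lp_functions_diff) (simp_all add: lp_space_eq)
  then show "lp_dist p x y = 0 \<longleftrightarrow> x = y"
    by (auto simp: AE_count_space fun_eq_iff)
  assume z: "z \<in> lp_space p"
  have "Lp_norm p (count_space UNIV) (\<lambda>i. (x i - y i) + (y i - z i))
      \<le> Lp_norm p (count_space UNIV) (\<lambda>i. x i - y i) + Lp_norm p (count_space UNIV) (\<lambda>i. y i - z i)"
    using x y z by (intro Lp_Minkowski p Lp_functions_diff) (simp_all add: lp_space_eq)
  then show "lp_dist p x z \<le> lp_dist p x y + lp_dist p y z"
    using x y z by (simp add: lp_dist_eq p)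
qed

lemma Lp_scale_class:
  assumes "\<phi> \<in> Lp_functions p M"
  shows "Lp_scale p M c (Lp_rel p M `` {\<phi>}) = Lp_rel p M `` {\<lambda>x. c * \<phi> x}"
  unfolding Lp_scale_def
proof (rule UN_equiv_class[OF equiv_Lp_rel _ assms], rule congruentI)
  fix f g assume "(f, g) \<in> Lp_rel p M"
  then have "(\<lambda>x. c * f x, \<lambda>x. c * g x) \<in> Lp_rel p M"
    by (auto simp: Lp_rel_def Lp_functions_scale)
  then show "Lp_rel p M `` {\<lambda>x. c * f x} = Lp_rel p M `` {\<lambda>x. c * g x}"
    by (rule equiv_class_eq[OF equiv_Lp_rel])
qed

context composition_system
begin

lemma AE_comp:
  assumes "AE x in M. P x"
  shows "AE x in M. P (f x)"
proof -
  obtain h where h: "h \<in> borel_measurable M" "density M h = distr M M f"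
    using RN_inv_f by (auto simp: RN_deriv_bounded_below_def)
  then have "AE x in distr M M f. P x"
    using assms unfolding h(2)[symmetric] AE_density[OF h(1)] by auto
  then show ?thesis
    by (rule AE_distrD[OF measurable_f])
qed

lemma nn_integral_comp_bound:
  "\<exists>c::real. c > 0 \<and> (\<forall>u \<in> borel_measurable M. ennreal c * (\<integral>\<^sup>+x. u (f x) \<partial>M) \<le> (\<integral>\<^sup>+x. u x \<partial>M))"
proof -
  let ?N = "distr M M (inv f)"
  obtain h c where h: "h \<in> borel_measurable M" "density M h = ?N"
    and c: "(c::real) > 0" "AE x in M. ennreal c \<le> RN_deriv M ?N x"
    using RN_f unfolding RN_deriv_bounded_below_def by blast
  have dens: "density M (RN_deriv M ?N) = ?N"
    using RN_derivI[OF h] .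
  note [measurable] = measurable_f measurable_inv_f
  have "ennreal c * (\<integral>\<^sup>+x. u (f x) \<partial>M) \<le> (\<integral>\<^sup>+x. u x \<partial>M)" if [measurable]: "u \<in> borel_measurable M" for u
  proof -
    have "ennreal c * (\<integral>\<^sup>+x. u (f x) \<partial>M) = (\<integral>\<^sup>+x. ennreal c * u (f x) \<partial>M)"
      by (simp add: nn_integral_cmult)
    also have "\<dots> \<le> (\<integral>\<^sup>+x. RN_deriv M ?N x * u (f x) \<partial>M)"
      using c(2) by (intro nn_integral_mono_AE) (auto elim!: eventually_mono intro: mult_right_mono)
    also have "\<dots> = (\<integral>\<^sup>+x. u (f x) \<partial>?N)"
      by (subst dens[symmetric], subst nn_integral_density) auto
    also have "\<dots> = (\<integral>\<^sup>+x. u x \<partial>M)"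
      using bij by (subst nn_integral_distr) (auto simp: bij_is_surj surj_f_inv_f)
    finally show ?thesis .
  qed
  with c show ?thesis by blast
qed

lemma Lp_functions_comp:
  assumes "\<phi> \<in> Lp_functions p M"
  shows "\<phi> \<circ> f \<in> Lp_functions p M"
proof -
  note [measurable] = measurable_f
  have [measurable]: "\<phi> \<in> borel_measurable M" and int: "integrable M (\<lambda>x. norm (\<phi> x) powr p)"
    using assms by (auto simp: Lp_functions_def)
  obtain c :: real where c: "c > 0"
    "\<forall>u \<in> borel_measurable M. ennreal c * (\<integral>\<^sup>+x. u (f x) \<partial>M) \<le> (\<integral>\<^sup>+x. u x \<partial>M)"
    using nn_integral_comp_bound by blast
  have "ennreal c * (\<integral>\<^sup>+x. ennreal (norm (\<phi> (f x)) powr p) \<partial>M) \<le> (\<integral>\<^sup>+x. ennreal (norm (\<phi> x) powr p) \<partial>M)"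
    using bspec[OF c(2), of "\<lambda>x. ennreal (norm (\<phi> x) powr p)"] by simp
  also have "\<dots> < \<infinity>"
    using int by (simp add: integrable_iff_bounded)
  finally have "(\<integral>\<^sup>+x. ennreal (norm (\<phi> (f x)) powr p) \<partial>M) < \<infinity>"
    using c(1) by (auto simp: ennreal_mult_less_top)
  then show ?thesis
    by (auto simp: Lp_functions_def integrable_iff_bounded)
qed

lemma composition_operator_class:
  assumes "\<phi> \<in> Lp_functions p M"
  shows "composition_operator p M f (Lp_rel p M `` {\<phi>}) = Lp_rel p M `` {\<phi> \<circ> f}"
  unfolding composition_operator_def
proof (rule UN_equiv_class[OF equiv_Lp_rel _ assms], rule congruentI)
  fix \<phi> \<psi> assume "(\<phi>, \<psi>) \<in> Lp_rel p M"
  then have "(\<phi> \<circ> f, \<psi> \<circ> f) \<in> Lp_rel p M"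
    using AE_comp[of "\<lambda>x. \<phi> x = \<psi> x"] Lp_functions_comp by (simp add: Lp_rel_def)
  then show "Lp_rel p M `` {\<phi> \<circ> f} = Lp_rel p M `` {\<psi> \<circ> f}"
    by (rule equiv_class_eq[OF equiv_Lp_rel])
qed

end

end

theory Submission
  imports Defs
begin

text \<open>Write \<open>m k = \<mu>(f\<^sup>k(W))\<close>. Both operators are supercyclic if and only if \<open>m n * m (- n)\<close> takes
  arbitrarily small values. If a multiple of \<open>\<phi> \<circ> f\<^sup>n\<close> is close to the indicator of \<open>W\<close>, then it is
  large on most of \<open>W\<close> and small on \<open>f\<^sup>j\<^sup>-\<^sup>n(W)\<close> whenever \<open>j \<noteq> n\<close>; by bounded distortion the first
  bounds \<open>m n\<close>, the second \<open>m (j - n)\<close>, and the unknown factor cancels in the product.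
  Conversely, let \<open>h\<^sub>l\<close> run through a dense sequence of bounded functions supported on finitely many
  \<open>f\<^sup>i(W)\<close>; then \<open>\<phi> = \<Sum>\<^sub>l a\<^sub>l h\<^sub>l \<circ> f\<^bsup>-n(l)\<^esup>\<close> is a supercyclic vector if \<open>n(l)\<close> grows fast enough for the
  supports to be disjoint and \<open>a\<^sub>l\<close> balances \<open>m (n(l))\<close> against \<open>m (- n(l))\<close>.
  The shift is the case of the translation on the integers with the measure that has weight \<open>m k\<close>
  at \<open>k\<close>.\<close>

section \<open>The \<open>p\<close>-th power of the norm as a nonnegative integral\<close>

text \<open>A factor map transports supercyclicity in one direction only, so the two operators are
  not compared with each other but each with the same numerical criterion. The criterion is a
  product because the scalars are free: rescaling a block of the vector trades one factor against
  the other, and only what is invariant under this trade can matter. In one direction the unknown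
  scalar has to be eliminated, in the other it is a parameter to be chosen. Distances are handled
  through p-th powers of norms with values in \<open>ennreal\<close>, so that estimates can be
  written down before integrability is known, and disjoint supports make these powers
  additive.\<close>

definition Lp_energy :: "real \<Rightarrow> 'a measure \<Rightarrow> ('a \<Rightarrow> complex) \<Rightarrow> ennreal" where
  "Lp_energy p M u = (\<integral>\<^sup>+x. ennreal (norm (u x) powr p) \<partial>M)"

lemma Lp_functions_iff_energy:
  "u \<in> Lp_functions p M \<longleftrightarrow> u \<in> borel_measurable M \<and> Lp_energy p M u < \<infinity>"
  by (auto simp: Lp_functions_def Lp_energy_def integrable_iff_bounded)

lemma Lp_energy_eq_Lp_norm:
  assumes "1 \<le> p" "u \<in> Lp_functions p M"
  shows "Lp_energy p M u = ennreal (Lp_norm p M u powr p)"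
  using assms by (simp add: Lp_energy_def Lp_norm_powr Lp_functions_def nn_integral_eq_integral)

lemma Lp_norm_less_iff_energy:
  assumes p: "1 \<le> p" and u: "u \<in> Lp_functions p M" and r: "0 < r"
  shows "Lp_norm p M u < r \<longleftrightarrow> Lp_energy p M u < ennreal (r powr p)"
proof -
  have "Lp_norm p M u < r \<longleftrightarrow> Lp_norm p M u powr p < r powr p"
    using p r powr_less_mono2[of p "Lp_norm p M u" r] powr_mono2[of p r "Lp_norm p M u"]
      Lp_norm_nonneg[of p M u] by linarith
  then show ?thesis
    using p u by (simp add: Lp_energy_eq_Lp_norm ennreal_less_iff)
qed

lemma Lp_energy_mono:
  assumes "0 \<le> p" "\<And>x. norm (u x) \<le> norm (v x)"
  shows "Lp_energy p M u \<le> Lp_energy p M v"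
  unfolding Lp_energy_def using assms
  by (intro nn_integral_mono ennreal_leI powr_mono2) auto

text \<open>The modulus of a sum is at most twice the larger modulus. This crude form of the
  triangle inequality for p-th powers is enough, since a fixed factor \<open>2 powr p\<close> can be
  absorbed into an arbitrarily small tolerance.\<close>

lemma Lp_energy_add:
  assumes p: "0 \<le> p" and [measurable]: "u \<in> borel_measurable M" "v \<in> borel_measurable M"
  shows "Lp_energy p M (\<lambda>x. u x + v x) \<le> ennreal (2 powr p) * (Lp_energy p M u + Lp_energy p M v)"
proof -
  have "norm (u x + v x) powr p \<le> 2 powr p * (norm (u x) powr p + norm (v x) powr p)" for x
  proof -
    have "norm (u x + v x) powr p \<le> (2 * max (norm (u x)) (norm (v x))) powr p"
      using p norm_triangle_ineq[of "u x" "v x"] by (intro powr_mono2) auto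
    also have "\<dots> = 2 powr p * max (norm (u x)) (norm (v x)) powr p"
      by (subst powr_mult) auto
    also have "\<dots> \<le> 2 powr p * (norm (u x) powr p + norm (v x) powr p)"
      by (auto simp: max_def)
    finally show ?thesis .
  qed
  then have "Lp_energy p M (\<lambda>x. u x + v x) \<le>
      (\<integral>\<^sup>+x. ennreal (2 powr p) * (ennreal (norm (u x) powr p) + ennreal (norm (v x) powr p)) \<partial>M)"
    unfolding Lp_energy_def
    by (intro nn_integral_mono) (auto simp: ennreal_mult[symmetric] ennreal_plus[symmetric] simp del: ennreal_plus)
  also have "\<dots> = ennreal (2 powr p) * (Lp_energy p M u + Lp_energy p M v)"
    unfolding Lp_energy_def by (simp add: nn_integral_cmult nn_integral_add)
  finally show ?thesis .
qed

lemma Lp_energy_triangle_less: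
  assumes p: "0 \<le> p"
    and [measurable]: "u \<in> borel_measurable M" "v \<in> borel_measurable M" "w \<in> borel_measurable M"
    and "Lp_energy p M (\<lambda>x. u x - v x) < ennreal (e / (2 * 2 powr p))"
    and "Lp_energy p M (\<lambda>x. v x - w x) < ennreal (e / (2 * 2 powr p))"
    and e: "0 < e"
  shows "Lp_energy p M (\<lambda>x. u x - w x) < ennreal e"
proof -
  let ?d = "e / (2 * 2 powr p)"
  have "Lp_energy p M (\<lambda>x. u x - w x) = Lp_energy p M (\<lambda>x. (u x - v x) + (v x - w x))"
    by simp
  also have "\<dots> \<le> ennreal (2 powr p) * (Lp_energy p M (\<lambda>x. u x - v x) + Lp_energy p M (\<lambda>x. v x - w x))"
    using p by (intro Lp_energy_add) auto
  also have "\<dots> < ennreal (2 powr p) * (ennreal ?d + ennreal ?d)"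
    using assms(5,6) by (intro ennreal_mult_strict_left_mono add_strict_mono) auto
  also have "\<dots> = ennreal e"
    using e by (simp add: ennreal_mult[symmetric] ennreal_plus[symmetric] field_simps del: ennreal_plus)
  finally show ?thesis .
qed

lemma Lp_energy_minus_commute: "Lp_energy p M (\<lambda>x. u x - v x) = Lp_energy p M (\<lambda>x. v x - u x)"
  by (simp add: Lp_energy_def norm_minus_commute)

lemma Lp_energy_scale:
  assumes [measurable]: "u \<in> borel_measurable M"
  shows "Lp_energy p M (\<lambda>x. c * u x) = ennreal (norm c powr p) * Lp_energy p M u"
  unfolding Lp_energy_def by (simp add: norm_mult powr_mult ennreal_mult nn_integral_cmult)

lemma Lp_energy_bounded_support:
  assumes p: "0 < p" and A: "A \<in> sets M" and b: "\<And>x. norm (u x) \<le> b" and supp: "\<And>x. x \<notin> A \<Longrightarrow> u x = 0"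
  shows "Lp_energy p M u \<le> ennreal (b powr p) * emeasure M A"
proof -
  have "Lp_energy p M u \<le> (\<integral>\<^sup>+x. ennreal (b powr p) * indicator A x \<partial>M)"
    unfolding Lp_energy_def
  proof (rule nn_integral_mono)
    fix x
    show "ennreal (norm (u x) powr p) \<le> ennreal (b powr p) * indicator A x"
      using p supp[of x] by (auto simp: indicator_def intro!: ennreal_leI powr_mono2 b)
  qed
  then show ?thesis
    using A by (simp add: nn_integral_cmult_indicator)
qed

lemma Lp_energy_Chebyshev:
  assumes p: "0 \<le> p" and A: "A \<in> sets M" and t: "0 \<le> t" "\<And>x. x \<in> A \<Longrightarrow> t \<le> norm (u x)"
  shows "ennreal (t powr p) * emeasure M A \<le> Lp_energy p M u"
proof -
  have "ennreal (t powr p) * emeasure M A = (\<integral>\<^sup>+x. ennreal (t powr p) * indicator A x \<partial>M)"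
    using A by (simp add: nn_integral_cmult_indicator)
  also have "\<dots> \<le> Lp_energy p M u"
    unfolding Lp_energy_def using p t
    by (intro nn_integral_mono) (auto simp: indicator_def intro!: ennreal_leI powr_mono2)
  finally show ?thesis .
qed

section \<open>Separability\<close>

text \<open>Building the algebra in stages indexed by the naturals makes its countability an
  induction over the stages.\<close>

primrec generated_algebra_stage :: "'a set set \<Rightarrow> nat \<Rightarrow> 'a set set" where
  "generated_algebra_stage G 0 = insert {} G"
| "generated_algebra_stage G (Suc n) =
     (let S = generated_algebra_stage G n in S \<union> uminus ` S \<union> (\<lambda>(X, Y). X \<union> Y) ` (S \<times> S))"

definition generated_algebra :: "'a set set \<Rightarrow> 'a set set" where
  "generated_algebra G = (\<Union>n. generated_algebra_stage G n)"

lemma countable_generated_algebra: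
  assumes "countable G"
  shows "countable (generated_algebra G)"
proof -
  have "countable (generated_algebra_stage G n)" for n
    using assms by (induction n) (auto simp: Let_def)
  then show ?thesis
    by (simp add: generated_algebra_def)
qed

lemma generated_algebra_base: "{} \<in> generated_algebra G" "X \<in> G \<Longrightarrow> X \<in> generated_algebra G"
  by (auto simp: generated_algebra_def intro!: exI[of _ 0])

lemma generated_algebra_Compl: "X \<in> generated_algebra G \<Longrightarrow> - X \<in> generated_algebra G"
proof -
  assume "X \<in> generated_algebra G"
  then obtain n where "X \<in> generated_algebra_stage G n"
    by (auto simp: generated_algebra_def)
  then have "- X \<in> generated_algebra_stage G (Suc n)"
    by (auto simp: Let_def)
  then show ?thesis
    unfolding generated_algebra_def by blast
qed

lemma generated_algebra_Un:
  assumes "X \<in> generated_algebra G" "Y \<in> generated_algebra G"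
  shows "X \<union> Y \<in> generated_algebra G"
proof -
  obtain m n where mn: "X \<in> generated_algebra_stage G m" "Y \<in> generated_algebra_stage G n"
    using assms by (auto simp: generated_algebra_def)
  have mono: "generated_algebra_stage G k \<subseteq> generated_algebra_stage G (k + l)" for k l
    by (induction l) (auto simp: Let_def)
  have "X \<in> generated_algebra_stage G (m + n)" "Y \<in> generated_algebra_stage G (m + n)"
    using mn mono[of m n] mono[of n m] by (auto simp: add.commute)
  then have "X \<union> Y \<in> generated_algebra_stage G (Suc (m + n))"
    by (auto simp: Let_def)
  then show ?thesis
    unfolding generated_algebra_def by blast
qed

lemma generated_algebra_sigma_sets: "X \<in> generated_algebra G \<Longrightarrow> X \<in> sigma_sets UNIV G"
proof -
  have "generated_algebra_stage G n \<subseteq> sigma_sets UNIV G" for n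
  proof (induction n)
    case (Suc n)
    then show ?case
      by (auto simp: Let_def Compl_eq_Diff_UNIV intro!: sigma_sets.Compl sigma_sets_Un)
  qed (auto intro: sigma_sets.intros)
  then show "X \<in> generated_algebra G \<Longrightarrow> X \<in> sigma_sets UNIV G"
    by (auto simp: generated_algebra_def)
qed

text \<open>The sets approximable in measure by the algebra form a sigma-algebra containing
  \<open>G\<close>. Symmetric differences are unchanged by complementing both sets, and continuity
  from below handles countable unions.\<close>

lemma (in finite_measure) generated_algebra_approx:
  assumes gen: "sets M = sigma_sets UNIV G" and A: "A \<in> sets M" and e: "(0::real) < e"
  shows "\<exists>D\<in>generated_algebra G. measure M (sym_diff A D) < e"
proof -
  have space: "space M = UNIV"
    using gen sigma_sets_top[of UNIV G] sets.sets_into_space by blast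
  have alg: "D \<in> sets M" if "D \<in> generated_algebra G" for D
    using that gen generated_algebra_sigma_sets by auto
  define P where "P A \<longleftrightarrow> A \<in> sets M \<and> (\<forall>e>0. \<exists>D\<in>generated_algebra G. measure M (sym_diff A D) < e)" for A
  have P_Un: "P (A \<union> B)" if "P A" "P B" for A B
    unfolding P_def
  proof (intro conjI allI impI)
    fix e :: real assume "0 < e"
    then obtain C D where CD: "C \<in> generated_algebra G" "measure M (sym_diff A C) < e / 2"
        "D \<in> generated_algebra G" "measure M (sym_diff B D) < e / 2"
      using \<open>P A\<close> \<open>P B\<close> unfolding P_def by (meson half_gt_zero)
    have [measurable]: "A \<in> sets M" "B \<in> sets M" "C \<in> sets M" "D \<in> sets M"
      using that CD alg by (auto simp: P_def)
    have "measure M (sym_diff (A \<union> B) (C \<union> D)) \<le> measure M (sym_diff A C \<union> sym_diff B D)"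
      by (intro finite_measure_mono) auto
    also have "\<dots> \<le> measure M (sym_diff A C) + measure M (sym_diff B D)"
      by (intro measure_Un_le) auto
    finally show "\<exists>D\<in>generated_algebra G. measure M (sym_diff (A \<union> B) D) < e"
      using CD generated_algebra_Un[of C G D] by (intro bexI[of _ "C \<union> D"]) auto
  qed (use that in \<open>auto simp: P_def\<close>)
  have P_empty: "P {}"
    unfolding P_def using generated_algebra_base(1)[of G] by (auto intro!: bexI[of _ "{}"])
  have "P A"
    using A unfolding gen
  proof (induction rule: sigma_sets.induct)
    case (Basic a)
    then show ?case
      unfolding P_def using generated_algebra_base(2)[of a G]
      by (auto simp: gen intro!: bexI[of _ a] sigma_sets.Basic)
  next
    case Empty
    show ?case by (rule P_empty)
  next
    case (Compl a)
    show ?case unfolding P_def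
    proof (intro conjI allI impI)
      show "UNIV - a \<in> sets M" using Compl(1) by (auto simp: gen intro: sigma_sets.Compl)
      fix e :: real assume "0 < e"
      then obtain D where D: "D \<in> generated_algebra G" "measure M (sym_diff a D) < e"
        using Compl(2) by (auto simp: P_def)
      moreover have "sym_diff (UNIV - a) (- D) = sym_diff a D" by auto
      ultimately show "\<exists>D\<in>generated_algebra G. measure M (sym_diff (UNIV - a) D) < e"
        using generated_algebra_Compl[of D G] by (intro bexI[of _ "- D"]) auto
    qed
  next
    case (Union a)
    \<comment> \<open>The algebra is closed under finite unions only, so the countable union is
      replaced by a partial one at the cost \<open>e / 2\<close>.\<close>
    define B where "B n = (\<Union>i<n. a i)" for n
    have [measurable]: "a i \<in> sets M" for i
      using Union(2) by (auto simp: P_def)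
    have PB: "P (B n)" for n
      unfolding B_def by (induction n) (auto simp: lessThan_Suc P_empty intro!: P_Un Union)
    have [measurable]: "B n \<in> sets M" for n
      using PB by (auto simp: P_def)
    have UB: "(\<Union>n. B n) = (\<Union>i. a i)"
      unfolding B_def by auto
    show ?case unfolding P_def
    proof (intro conjI allI impI)
      show "(\<Union>i. a i) \<in> sets M" by auto
      fix e :: real assume e: "0 < e"
      have "(\<lambda>n. measure M (B n)) \<longlonglongrightarrow> measure M (\<Union>n. B n)"
        by (intro finite_Lim_measure_incseq) (force simp: B_def incseq_def)+
      from LIMSEQ_D[OF this, of "e/2"] e obtain n
        where n: "\<bar>measure M (B n) - measure M (\<Union>i. a i)\<bar> < e / 2"
        unfolding UB by auto
      obtain D where D: "D \<in> generated_algebra G" "measure M (sym_diff (B n) D) < e / 2"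
        using PB[of n] e unfolding P_def by (meson half_gt_zero)
      have [measurable]: "D \<in> sets M" using D alg by auto
      have sub: "B n \<subseteq> (\<Union>i. a i)" by (auto simp: B_def)
      have "measure M (sym_diff (\<Union>i. a i) D) \<le> measure M (((\<Union>i. a i) - B n) \<union> sym_diff (B n) D)"
        by (intro finite_measure_mono) (use sub in auto)
      also have "\<dots> \<le> measure M ((\<Union>i. a i) - B n) + measure M (sym_diff (B n) D)"
        by (intro measure_Un_le) auto
      also have "measure M ((\<Union>i. a i) - B n) = measure M (\<Union>i. a i) - measure M (B n)"
        using sub by (intro finite_measure_Diff) auto
      finally show "\<exists>D\<in>generated_algebra G. measure M (sym_diff (\<Union>i. a i) D) < e"
        using D n unfolding abs_less_iff by (intro bexI[of _ D]) linarith+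
    qed
  qed
  then show ?thesis
    using e by (auto simp: P_def)
qed

section \<open>Density of countably many step functions\<close>

text \<open>Coding by lists makes countability immediate once coefficients and sets come from
  countable collections, and turns concatenation into addition. The intersection with
  \<open>E i\<close> confines each function to finitely many of the sets \<open>E i\<close>.\<close>

definition step_function :: "(int \<Rightarrow> 'a set) \<Rightarrow> (complex \<times> 'a set \<times> int) list \<Rightarrow> 'a \<Rightarrow> complex" where
  "step_function E L x = (\<Sum>(c, D, i)\<leftarrow>L. c * indicator (D \<inter> E i) x)"

lemma step_function_simps [simp]:
  "step_function E [] x = 0"
  "step_function E ((c, D, i) # L) x = c * indicator (D \<inter> E i) x + step_function E L x"
  "step_function E (L @ L') x = step_function E L x + step_function E L' x"
  by (simp_all add: step_function_def)

lemma step_function_bounded: "\<exists>b. \<forall>x. norm (step_function E L x) \<le> b"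
proof (induction L)
  case (Cons a L)
  obtain c D i where a: "a = (c, D, i)" by (cases a)
  obtain b where b: "\<And>x. norm (step_function E L x) \<le> b" using Cons by blast
  have "norm (step_function E (a # L) x) \<le> norm c + b" for x
    unfolding a step_function_simps
    by (rule order_trans[OF norm_triangle_ineq add_mono[OF _ b]]) (auto simp: indicator_def)
  then show ?case by blast
qed auto

lemma step_function_support:
  "\<exists>q::nat. \<forall>x. step_function E L x \<noteq> 0 \<longrightarrow> (\<exists>i. \<bar>i\<bar> \<le> int q \<and> x \<in> E i)"
proof (induction L)
  case (Cons a L)
  obtain c D i where a: "a = (c, D, i)" by (cases a)
  obtain q :: nat where q: "\<And>x. step_function E L x \<noteq> 0 \<Longrightarrow> \<exists>i. \<bar>i\<bar> \<le> int q \<and> x \<in> E i"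
    using Cons by blast
  show ?case
  proof (intro exI[of _ "max q (nat \<bar>i\<bar>)"] allI impI)
    fix x assume nz: "step_function E (a # L) x \<noteq> 0"
    show "\<exists>j. \<bar>j\<bar> \<le> int (max q (nat \<bar>i\<bar>)) \<and> x \<in> E j"
    proof (cases "x \<in> E i")
      case True
      then show ?thesis by (intro exI[of _ i]) auto
    next
      case False
      then have "step_function E L x \<noteq> 0" using nz by (auto simp: a)
      from q[OF this] show ?thesis by (force simp: le_max_iff_disj)
    qed
  qed
qed auto

lemma step_function_measurable:
  assumes "\<And>i. E i \<in> sets M" "\<And>c D i. (c, D, i) \<in> set L \<Longrightarrow> D \<in> sets M"
  shows "step_function E L \<in> borel_measurable M"
  using assms(2)
proof (induction L)
  case (Cons a L)
  obtain c D i where a: "a = (c, D, i)" by (cases a)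
  have [measurable]: "D \<in> sets M" "E i \<in> sets M" "step_function E L \<in> borel_measurable M"
    using Cons assms(1) by (auto simp: a)
  have "(\<lambda>x. c * indicator (D \<inter> E i) x + step_function E L x) \<in> borel_measurable M"
    by measurable
  also have "(\<lambda>x. c * indicator (D \<inter> E i) x + step_function E L x) = step_function E (a # L)"
    by (simp add: a fun_eq_iff)
  finally show ?case .
qed (simp add: step_function_def[abs_def])

context
  fixes p :: real and M :: "'a measure" and G :: "'a set set" and E :: "int \<Rightarrow> 'a set"
  assumes p: "1 \<le> p" and gen: "sets M = sigma_sets UNIV G"
    and E_sets [measurable]: "\<And>i. E i \<in> sets M" and E_fin: "\<And>i. emeasure M (E i) < \<infinity>"
    and E_cover: "(\<Union>i. E i) = UNIV" and E_disj: "disjoint_family E"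
begin

private definition Q :: "complex set" where
  "Q = (SOME D. countable D \<and> (\<forall>X. open X \<longrightarrow> X \<noteq> {} \<longrightarrow> (\<exists>d\<in>D. d \<in> X)))"

private lemma Q: "countable Q" "open X \<Longrightarrow> X \<noteq> {} \<Longrightarrow> \<exists>d\<in>Q. d \<in> X"
  using someI_ex[OF countable_dense_exists[where 'a = complex]] unfolding Q_def by blast+

private definition steps :: "(complex \<times> 'a set \<times> int) list set" where
  "steps = lists (Q \<times> generated_algebra G \<times> UNIV)"

private lemma steps_measurable [measurable]:
  "L \<in> steps \<Longrightarrow> step_function E L \<in> borel_measurable M"
  by (rule step_function_measurable[OF E_sets]) (auto simp: steps_def gen intro: generated_algebra_sigma_sets)

text \<open>The closure of the coded step functions with respect to the energy of differences. The
  aim is to show that it contains all of \<open>Lp_functions p M\<close>.\<close>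

private definition Appr :: "('a \<Rightarrow> complex) set" where
  "Appr = {u \<in> borel_measurable M. \<forall>e>0. \<exists>L\<in>steps. Lp_energy p M (\<lambda>x. u x - step_function E L x) < ennreal e}"

private lemma Appr_add:
  assumes "u \<in> Appr" "v \<in> Appr"
  shows "(\<lambda>x. u x + v x) \<in> Appr"
  unfolding Appr_def
proof (intro CollectI conjI allI impI)
  have [measurable]: "u \<in> borel_measurable M" "v \<in> borel_measurable M"
    using assms by (auto simp: Appr_def)
  show "(\<lambda>x. u x + v x) \<in> borel_measurable M" by measurable
  fix e :: real assume e: "0 < e"
  define d where "d = e / (2 * 2 powr p)"
  have d: "0 < d" using e by (simp add: d_def)
  obtain L where L [measurable]: "L \<in> steps" "Lp_energy p M (\<lambda>x. u x - step_function E L x) < ennreal d"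
    using assms d by (auto simp: Appr_def)
  obtain L' where L' [measurable]: "L' \<in> steps" "Lp_energy p M (\<lambda>x. v x - step_function E L' x) < ennreal d"
    using assms d by (auto simp: Appr_def)
  have "Lp_energy p M (\<lambda>x. (u x + v x) - (step_function E L x + step_function E L' x)) < ennreal e"
  proof (rule Lp_energy_triangle_less)
    show "Lp_energy p M (\<lambda>x. u x + v x - (step_function E L x + v x)) < ennreal (e / (2 * 2 powr p))"
      "Lp_energy p M (\<lambda>x. step_function E L x + v x - (step_function E L x + step_function E L' x))
        < ennreal (e / (2 * 2 powr p))"
      using L L' by (simp_all add: d_def)
  qed (use p e L(1) L'(1) in auto)
  moreover have "L @ L' \<in> steps"
    using L(1) L'(1) by (simp add: steps_def)
  ultimately show "\<exists>L\<in>steps. Lp_energy p M (\<lambda>x. (u x + v x) - step_function E L x) < ennreal e"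
    by (intro bexI[of _ "L @ L'"]) auto
qed

private lemma Appr_limit:
  assumes u [measurable]: "u \<in> borel_measurable M"
    and lim: "\<And>e. 0 < e \<Longrightarrow> \<exists>v\<in>Appr. Lp_energy p M (\<lambda>x. u x - v x) < ennreal e"
  shows "u \<in> Appr"
  unfolding Appr_def
proof (intro CollectI conjI allI impI u)
  fix e :: real assume e: "0 < e"
  define d where "d = e / (2 * 2 powr p)"
  have d: "0 < d" using e by (simp add: d_def)
  obtain v where v: "v \<in> Appr" "Lp_energy p M (\<lambda>x. u x - v x) < ennreal d"
    using lim[OF d] by blast
  then have [measurable]: "v \<in> borel_measurable M" by (auto simp: Appr_def)
  obtain L where L: "L \<in> steps" "Lp_energy p M (\<lambda>x. v x - step_function E L x) < ennreal d"
    using v d by (auto simp: Appr_def)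
  have "Lp_energy p M (\<lambda>x. u x - step_function E L x) < ennreal e"
    by (rule Lp_energy_triangle_less[of p u M v]) (use p e v(2) L in \<open>simp_all add: d_def\<close>)
  with L show "\<exists>L\<in>steps. Lp_energy p M (\<lambda>x. u x - step_function E L x) < ennreal e"
    by blast
qed

private lemma Appr_sum:
  assumes "finite I" "\<And>i. i \<in> I \<Longrightarrow> u i \<in> Appr"
  shows "(\<lambda>x. \<Sum>i\<in>I. u i x) \<in> Appr"
  using assms
proof (induction I rule: finite_induct)
  case empty
  have "[] \<in> steps" by (simp add: steps_def)
  then show ?case
    by (auto simp: Appr_def Lp_energy_def intro!: bexI[of _ "[]"])
qed (simp add: Appr_add)

text \<open>Two errors are treated separately: the set is replaced by one of the algebra for a
  coefficient in \<open>Q\<close>, then an arbitrary coefficient is replaced by one in the dense set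
  \<open>Q\<close>.\<close>

private lemma Appr_indicator:
  assumes A [measurable]: "A \<in> sets M"
  shows "(\<lambda>x. c * indicator (A \<inter> E i) x) \<in> Appr"
proof -
  have dense_coeff: "(\<lambda>x. d * indicator (A \<inter> E i) x) \<in> Appr" if d: "d \<in> Q" for d
    unfolding Appr_def
  proof (intro CollectI conjI allI impI)
    fix e :: real assume e: "0 < e"
    \<comment> \<open>The restriction of \<open>M\<close> to \<open>E i\<close> is a finite measure,
      to which the approximation by the algebra applies.\<close>
    define N where "N = density M (indicator (E i))"
    have sets_N: "sets N = sets M" by (simp add: N_def)
    have emN: "emeasure N B = emeasure M (B \<inter> E i)" if "B \<in> sets M" for B
      using that by (simp add: N_def emeasure_restricted Int_commute)
    have spM: "space M = UNIV"
      using gen sigma_sets_top[of UNIV G] sets.sets_into_space by blast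
    interpret N: finite_measure N
      using E_fin[of i] emN[of UNIV] sets.top[of M] spM
      by (intro finite_measureI) (auto simp: N_def)
    \<comment> \<open>The summand 1 keeps the divisor positive when \<open>d = 0\<close>;
      \<open>m\<close> below is built in the same way for \<open>E i\<close> of measure
      zero.\<close>
    define d' where "d' = norm d powr p + 1"
    have d': "0 < d'" unfolding d'_def by (simp add: add_nonneg_pos)
    obtain D where D: "D \<in> generated_algebra G" "measure N (sym_diff A D) < e / d'"
      using N.generated_algebra_approx[of G A "e / d'"] gen sets_N A e d' by auto
    have [measurable]: "D \<in> sets M" using D gen generated_algebra_sigma_sets by auto
    have "Lp_energy p M (\<lambda>x. d * indicator (A \<inter> E i) x - step_function E [(d, D, i)] x)
        \<le> ennreal (norm d powr p) * emeasure M (sym_diff A D \<inter> E i)"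
      using p by (intro Lp_energy_bounded_support) (auto simp: indicator_def)
    also have "\<dots> = ennreal (norm d powr p) * ennreal (measure N (sym_diff A D))"
      by (subst emN[symmetric]) (auto simp: N.emeasure_eq_measure)
    also have "\<dots> \<le> ennreal (d' * measure N (sym_diff A D))"
      by (auto simp: ennreal_mult[symmetric] d'_def intro!: ennreal_leI mult_right_mono)
    also have "\<dots> < ennreal e"
      using D d' e by (intro ennreal_lessI) (auto simp: field_simps)
    finally show "\<exists>L\<in>steps. Lp_energy p M (\<lambda>x. d * indicator (A \<inter> E i) x - step_function E L x) < ennreal e"
      using D d by (intro bexI[of _ "[(d, D, i)]"]) (auto simp: steps_def)
  qed auto
  show ?thesis
  proof (rule Appr_limit)
    fix e :: real assume e: "0 < e"
    define m where "m = measure M (E i) + 1"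
    have m: "0 < m" unfolding m_def by (simp add: add_nonneg_pos)
    define r where "r = (e / m) powr (1 / p)"
    have r: "0 < r" using e m by (simp add: r_def)
    obtain d where d: "d \<in> Q" "d \<in> ball c r"
      using Q(2)[of "ball c r"] r by (auto simp del: mem_ball)
    have "Lp_energy p M (\<lambda>x. c * indicator (A \<inter> E i) x - d * indicator (A \<inter> E i) x)
        \<le> ennreal (dist c d powr p) * emeasure M (E i)"
      using p by (intro Lp_energy_bounded_support) (auto simp: indicator_def dist_norm)
    also have "\<dots> = ennreal (dist c d powr p * measure M (E i))"
      using E_fin[of i] by (simp add: emeasure_eq_ennreal_measure ennreal_mult)
    also have "\<dots> \<le> ennreal (r powr p * measure M (E i))"
      using d p by (intro ennreal_leI mult_right_mono powr_mono2) auto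
    also have "r powr p = e / m"
      using p e m by (simp add: r_def powr_powr)
    also have "ennreal (e / m * measure M (E i)) < ennreal e"
      using e m by (intro ennreal_lessI) (auto simp: field_simps m_def)
    finally show "\<exists>v\<in>Appr. Lp_energy p M (\<lambda>x. c * indicator (A \<inter> E i) x - v x) < ennreal e"
      using dense_coeff[OF d(1)] by (rule rev_bexI[rotated])
  qed auto
qed

private lemma Appr_simple:
  assumes g: "simple_function M g" and I: "finite I"
  shows "(\<lambda>x. g x * indicator (\<Union>i\<in>I. E i) x) \<in> Appr"
proof -
  have spM: "space M = UNIV"
    using gen sigma_sets_top[of UNIV G] sets.sets_into_space by blast
  have fin: "finite (range g)"
    using g by (simp add: simple_function_def spM)
  have "(\<lambda>x. \<Sum>i\<in>I. \<Sum>c\<in>range g. c * indicator (g -` {c} \<inter> E i) x) \<in> Appr"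
    using I fin g by (intro Appr_sum Appr_indicator) (auto simp: simple_function_def spM)
  also have "(\<lambda>x. \<Sum>i\<in>I. \<Sum>c\<in>range g. c * indicator (g -` {c} \<inter> E i) x)
      = (\<lambda>x. g x * indicator (\<Union>i\<in>I. E i) x)"
  proof
    fix x
    have "(\<Sum>c\<in>range g. c * indicator (g -` {c} \<inter> E i) x) = g x * indicator (E i) x" for i
    proof -
      have "(\<Sum>c\<in>range g. c * indicator (g -` {c} \<inter> E i) x)
          = (\<Sum>c\<in>range g. if c = g x then g x * indicator (E i) x else 0)"
        by (intro sum.cong) (auto simp: indicator_def)
      then show ?thesis using fin by simp
    qed
    then show "(\<Sum>i\<in>I. \<Sum>c\<in>range g. c * indicator (g -` {c} \<inter> E i) x) = g x * indicator (\<Union>i\<in>I. E i) x"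
      using I disjoint_family_on_mono[OF subset_UNIV E_disj, of I]
      by (simp add: indicator_UN_disjoint sum_distrib_left)
  qed
  finally show ?thesis .
qed

text \<open>Dominated convergence for simple functions bounded by twice the modulus of
  \<open>u\<close> and cut off outside the \<open>E i\<close> with
  \<open>\<bar>i\<bar> \<le> n\<close>. The difference from \<open>u\<close> is at most three times
  the modulus of \<open>u\<close>, both inside and outside the cut.\<close>

private lemma Appr_Lp_functions:
  assumes u: "u \<in> Lp_functions p M"
  shows "u \<in> Appr"
proof (rule Appr_limit)
  have um [measurable]: "u \<in> borel_measurable M" and fin: "Lp_energy p M u < \<infinity>"
    using u by (auto simp: Lp_functions_iff_energy)
  show "u \<in> borel_measurable M" by fact
  have spM: "space M = UNIV"
    using gen sigma_sets_top[of UNIV G] sets.sets_into_space by blast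
  obtain g where g: "\<And>n. simple_function M (g n)" "\<And>x. (\<lambda>n. g n x) \<longlonglongrightarrow> u x"
    "\<And>n x. dist (g n x) 0 \<le> 2 * dist (u x) 0"
    using borel_measurable_implies_sequence_metric[OF um, of 0] by (auto simp: spM)
  define v where "v n x = g n x * indicator (\<Union>i\<in>{- int n..int n}. E i) x" for n x
  have vA: "v n \<in> Appr" for n
    unfolding v_def by (intro Appr_simple g) auto
  have [measurable]: "v n \<in> borel_measurable M" for n
    using vA[of n] by (simp add: Appr_def)
  have "(\<lambda>n. \<integral>\<^sup>+x. ennreal (norm (u x - v n x) powr p) \<partial>M) \<longlonglongrightarrow> (\<integral>\<^sup>+x. 0 \<partial>M)"
  proof (rule nn_integral_dominated_convergence)
    show "AE x in M. ennreal (norm (u x - v n x) powr p) \<le> ennreal (3 powr p) * ennreal (norm (u x) powr p)" for n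
    proof (intro AE_I2)
      fix x
      have "norm (u x - v n x) \<le> 3 * norm (u x)"
        using g(3)[of n x] norm_triangle_ineq4[of "u x" "g n x"]
        by (auto simp: v_def indicator_def)
      then have "norm (u x - v n x) powr p \<le> (3 * norm (u x)) powr p"
        using p by (intro powr_mono2) auto
      also have "\<dots> = 3 powr p * norm (u x) powr p"
        by (subst powr_mult) auto
      finally show "ennreal (norm (u x - v n x) powr p) \<le> ennreal (3 powr p) * ennreal (norm (u x) powr p)"
        by (simp add: ennreal_mult[symmetric])
    qed
    have "(\<integral>\<^sup>+x. ennreal (3 powr p) * ennreal (norm (u x) powr p) \<partial>M) = ennreal (3 powr p) * Lp_energy p M u"
      unfolding Lp_energy_def by (simp add: nn_integral_cmult)
    then show "(\<integral>\<^sup>+x. ennreal (3 powr p) * ennreal (norm (u x) powr p) \<partial>M) < \<infinity>"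
      using fin by (simp add: ennreal_mult_less_top)
    show "AE x in M. (\<lambda>n. ennreal (norm (u x - v n x) powr p)) \<longlonglongrightarrow> 0"
    proof (intro AE_I2)
      fix x
      obtain i where i: "x \<in> E i" using E_cover by blast
      have "\<forall>\<^sub>F n in sequentially. v n x = g n x"
        using eventually_ge_at_top[of "nat \<bar>i\<bar>"]
        by eventually_elim (use i in \<open>force simp: v_def indicator_def\<close>)
      then have "(\<lambda>n. v n x) \<longlonglongrightarrow> u x"
        using g(2)[of x] tendsto_cong by fast
      from tendsto_diff[OF tendsto_const[of "u x"] this]
      have "(\<lambda>n. norm (u x - v n x)) \<longlonglongrightarrow> 0"
        by (simp add: tendsto_norm_zero)
      then have "(\<lambda>n. norm (u x - v n x) powr p) \<longlonglongrightarrow> 0 powr p"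
        using p by (intro tendsto_powr' tendsto_const) auto
      then show "(\<lambda>n. ennreal (norm (u x - v n x) powr p)) \<longlonglongrightarrow> 0"
        using tendsto_ennrealI by fastforce
    qed
  qed measurable
  then have lim: "(\<lambda>n. Lp_energy p M (\<lambda>x. u x - v n x)) \<longlonglongrightarrow> 0"
    by (simp add: Lp_energy_def)
  fix e :: real assume "0 < e"
  then have "\<forall>\<^sub>F n in sequentially. Lp_energy p M (\<lambda>x. u x - v n x) < ennreal e"
    using lim by (intro order_tendstoD(2)) auto
  then obtain n where "Lp_energy p M (\<lambda>x. u x - v n x) < ennreal e"
    by (meson eventually_happens' sequentially_bot)
  with vA show "\<exists>v\<in>Appr. Lp_energy p M (\<lambda>x. u x - v x) < ennreal e" by blast
qed

text \<open>The bound \<open>b\<close> and the width \<open>q\<close> of the support are recorded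
  with each member because the energy of its translates is estimated from them.\<close>

lemma Lp_functions_dense_sequence:
  assumes "countable G"
  obtains H :: "nat \<Rightarrow> 'a \<Rightarrow> complex" and b :: "nat \<Rightarrow> real" and q :: "nat \<Rightarrow> nat"
  where "\<And>l. H l \<in> borel_measurable M" "\<And>l x. norm (H l x) \<le> b l"
    "\<And>l x. H l x \<noteq> 0 \<Longrightarrow> \<exists>i. \<bar>i\<bar> \<le> int (q l) \<and> x \<in> E i"
    "\<And>u e. u \<in> Lp_functions p M \<Longrightarrow> 0 < e \<Longrightarrow> \<exists>l. Lp_energy p M (\<lambda>x. H l x - u x) < ennreal e"
proof -
  define S where "S = from_nat_into steps"
  have cnt: "countable steps"
    unfolding steps_def using Q(1) countable_generated_algebra[OF assms]
    by (intro countable_lists countable_SIGMA) auto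
  have ne: "steps \<noteq> {}" by (auto simp: steps_def)
  have S: "S l \<in> steps" for l
    unfolding S_def by (rule from_nat_into[OF ne])
  have "\<exists>b. \<forall>l x. norm (step_function E (S l) x) \<le> b l"
    by (intro choice allI step_function_bounded)
  then obtain b where b: "\<And>l x. norm (step_function E (S l) x) \<le> b l" by blast
  have "\<exists>q::nat \<Rightarrow> nat. \<forall>l x. step_function E (S l) x \<noteq> 0 \<longrightarrow> (\<exists>i. \<bar>i\<bar> \<le> int (q l) \<and> x \<in> E i)"
    by (intro choice allI step_function_support)
  then obtain q :: "nat \<Rightarrow> nat" where q:
    "\<And>l x. step_function E (S l) x \<noteq> 0 \<Longrightarrow> \<exists>i. \<bar>i\<bar> \<le> int (q l) \<and> x \<in> E i" by blast
  have dense: "\<exists>l. Lp_energy p M (\<lambda>x. step_function E (S l) x - u x) < ennreal e"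
    if u: "u \<in> Lp_functions p M" and e: "0 < e" for u e
  proof -
    obtain L where L: "L \<in> steps" "Lp_energy p M (\<lambda>x. u x - step_function E L x) < ennreal e"
      using Appr_Lp_functions[OF u] e by (auto simp: Appr_def)
    obtain l where "S l = L"
      using from_nat_into_surj[OF cnt L(1)] by (auto simp: S_def)
    then show ?thesis
      using L by (subst Lp_energy_minus_commute) auto
  qed
  show thesis
    by (rule that[of "\<lambda>l. step_function E (S l)", OF _ b q dense]) (use S in auto)
qed

end

section \<open>Integer iterates\<close>

lemma int_iterate_0 [simp]: "int_iterate f 0 = id"
  by (simp add: int_iterate_def)

lemma int_iterate_of_nat: "int_iterate f (int n) = f ^^ n"
  by (simp add: int_iterate_def)

lemma int_iterate_add1:
  assumes "bij f"
  shows "int_iterate f (k + 1) = f \<circ> int_iterate f k"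
proof (cases "0 \<le> k")
  case True
  then show ?thesis
    by (simp add: int_iterate_def nat_add_distrib)
next
  case False
  then have "nat (- k) = Suc (nat (- (k + 1)))" by simp
  with False assms show ?thesis
    by (auto simp: int_iterate_def fun_eq_iff bij_is_surj surj_f_inv_f)
qed

lemma int_iterate_diff1:
  assumes "bij f"
  shows "int_iterate f (k - 1) = inv f \<circ> int_iterate f k"
  using int_iterate_add1[OF assms, of "k - 1"] assms
  by (auto simp: fun_eq_iff bij_is_inj inv_f_f)

lemma int_iterate_add:
  assumes "bij f"
  shows "int_iterate f (i + j) = int_iterate f i \<circ> int_iterate f j"
proof (induction i rule: int_induct[where k = 0])
  case (step1 i)
  have "int_iterate f (i + 1 + j) = int_iterate f ((i + j) + 1)" by (simp add: ac_simps)
  then show ?case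
    using step1 by (simp only: int_iterate_add1[OF assms]) (simp add: comp_assoc)
next
  case (step2 i)
  have "int_iterate f (i - 1 + j) = int_iterate f ((i + j) - 1)" by (simp add: algebra_simps)
  then show ?case
    using step2 by (simp only: int_iterate_diff1[OF assms]) (simp add: comp_assoc)
qed simp

lemma int_iterate_image_add:
  "bij f \<Longrightarrow> int_iterate f i ` int_iterate f j ` A = int_iterate f (i + j) ` A"
  by (simp add: int_iterate_add image_comp)

lemma int_iterate_apply_add:
  "bij f \<Longrightarrow> int_iterate f i (int_iterate f j x) = int_iterate f (i + j) x"
  by (simp add: int_iterate_add)

text \<open>Turns images into preimages, so that measurability of the iterates gives measurability
  of the sets they carry along.\<close>

lemma int_iterate_image_eq_vimage:
  assumes "bij f"
  shows "int_iterate f k ` A = int_iterate f (- k) -` A"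
proof safe
  fix x assume "int_iterate f (- k) x \<in> A"
  then show "x \<in> int_iterate f k ` A"
    by (intro image_eqI[of _ _ "int_iterate f (- k) x"]) (simp_all add: int_iterate_apply_add[OF assms])
qed (simp add: int_iterate_apply_add[OF assms])

lemma measurable_int_iterate:
  assumes "f \<in> measurable M M" "inv f \<in> measurable M M"
  shows "int_iterate f k \<in> measurable M M"
  using measurable_compose_n[OF assms(1)] measurable_compose_n[OF assms(2)]
  by (auto simp: int_iterate_def)

section \<open>Supercyclicity in terms of the measures of the wandering sets\<close>

text \<open>Supercyclicity on representatives and with p-th powers of distances, so that the
  criterion can be proved away from quotients and metric topologies.\<close>

definition function_supercyclic :: "real \<Rightarrow> 'a measure \<Rightarrow> ('a \<Rightarrow> 'a) \<Rightarrow> bool" where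
  "function_supercyclic p M f \<longleftrightarrow> (\<exists>\<phi>\<in>Lp_functions p M. \<forall>u\<in>Lp_functions p M. \<forall>e>0.
     \<exists>n c. Lp_energy p M (\<lambda>x. c * \<phi> ((f ^^ n) x) - u x) < ennreal e)"

text \<open>This covers the given system as well as the translation of a weighted counting measure
  on the integers, whose composition operator is the weighted shift.\<close>

locale wandering_system =
  fixes M :: "'a measure" and f :: "'a \<Rightarrow> 'a" and W :: "'a set" and G :: "'a set set"
  assumes bij: "bij f"
    and measurable_f: "f \<in> measurable M M"
    and measurable_inv_f: "inv f \<in> measurable M M"
    and countable_G: "countable G"
    and sets_gen: "sets M = sigma_sets UNIV G"
    and W_sets: "W \<in> sets M"
    and W_cover: "(\<Union>k. int_iterate f k ` W) = UNIV"
    and W_disjoint: "disjoint_family (\<lambda>k. int_iterate f k ` W)"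
    and orbit_finite: "\<And>k. emeasure M (int_iterate f k ` W) < \<infinity>"
    and orbit_pos: "\<And>k. 0 < emeasure M (int_iterate f k ` W)"
    and ratio: "\<exists>C. \<forall>k. measure M (int_iterate f (k + 1) ` W) \<le> C * measure M (int_iterate f k ` W) \<and>
      measure M (int_iterate f k ` W) \<le> C * measure M (int_iterate f (k + 1) ` W)"
    and distortion: "\<exists>K::real. \<forall>k. \<forall>B\<in>sets M. B \<subseteq> W \<longrightarrow>
      measure M (int_iterate f k ` W) * measure M B \<le> K * (measure M (int_iterate f k ` B) * measure M W) \<and>
      measure M (int_iterate f k ` B) * measure M W \<le> K * (measure M (int_iterate f k ` W) * measure M B)"
begin

abbreviation F :: "int \<Rightarrow> 'a \<Rightarrow> 'a" where "F \<equiv> int_iterate f"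

definition m :: "int \<Rightarrow> real" where "m k = measure M (F k ` W)"

lemma m_pos: "0 < m k"
  using orbit_pos[of k] orbit_finite[of k] by (simp add: m_def measure_def enn2real_positive_iff)

lemma emeasure_orbit: "emeasure M (F k ` W) = ennreal (m k)"
  using orbit_finite[of k] by (simp add: m_def emeasure_eq_ennreal_measure)

lemma space_M [simp]: "space M = UNIV"
  using sets_gen sigma_sets_top[of UNIV G] sets.sets_into_space by blast

lemma measurable_F [measurable]: "F k \<in> measurable M M"
  by (intro measurable_int_iterate measurable_f measurable_inv_f)

lemma measurable_funpow_f [measurable]: "f ^^ n \<in> measurable M M"
  using measurable_F[of "int n"] by (simp add: int_iterate_of_nat)

lemma sets_F_image [measurable]: "A \<in> sets M \<Longrightarrow> F k ` A \<in> sets M"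
  using measurable_sets[OF measurable_F[of "- k"], of A]
  by (simp add: int_iterate_image_eq_vimage[OF bij])

lemma F_F_image: "F i ` F j ` A = F (i + j) ` A"
  by (rule int_iterate_image_add[OF bij])

lemma F_F: "F i (F j x) = F (i + j) x"
  by (rule int_iterate_apply_add[OF bij])

lemma emeasure_sub_orbit:
  assumes "A \<in> sets M" "A \<subseteq> F k ` W"
  shows "emeasure M A = ennreal (measure M A)"
  using emeasure_mono[OF assms(2), of M] assms(1) W_sets orbit_finite[of k]
  by (intro emeasure_eq_ennreal_measure) (auto simp: top_unique)

text \<open>Iterates the ratio bound in both directions. Its use is that spreading a function over
  finitely many orbit sets, or shifting the index by a fixed amount, costs only a constant
  factor.\<close>

lemma ratio_iterate: "\<exists>C\<ge>1. \<forall>k i. m (k + i) \<le> C ^ nat \<bar>i\<bar> * m k"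
proof -
  obtain C0 where C0: "\<And>k. m (k + 1) \<le> C0 * m k" "\<And>k. m k \<le> C0 * m (k + 1)"
    using ratio by (auto simp: m_def)
  define C where "C = max 1 C0"
  have C: "m (k + 1) \<le> C * m k" "m k \<le> C * m (k + 1)" for k
    using mult_right_mono[of C0 C "m k"] mult_right_mono[of C0 C "m (k + 1)"] C0[of k]
      m_pos[of k] m_pos[of "k + 1"] by (auto simp: C_def intro: order_trans)
  have "m (k + int n) \<le> C ^ n * m k \<and> m (k - int n) \<le> C ^ n * m k" for k n
  proof (induction n)
    case (Suc n)
    have "m (k + int (Suc n)) \<le> C * m (k + int n)" "m (k - int (Suc n)) \<le> C * m (k - int n)"
      using C(1)[of "k + int n"] C(2)[of "k - int (Suc n)"] by (simp_all add: algebra_simps)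
    moreover have "C * m (k + int n) \<le> C * (C ^ n * m k)" "C * m (k - int n) \<le> C * (C ^ n * m k)"
      using Suc by (auto intro!: mult_left_mono simp: C_def)
    ultimately show ?case by (auto simp: mult.assoc)
  qed simp
  then have "m (k + i) \<le> C ^ nat \<bar>i\<bar> * m k" for k i
    by (cases i rule: int_cases2) auto
  then show ?thesis
    by (intro exI[of _ C]) (auto simp: C_def)
qed

lemma indicator_orbit_Lp_functions:
  assumes "0 < p" "finite I"
  shows "(indicator (\<Union>i\<in>I. F i ` W) :: 'a \<Rightarrow> complex) \<in> Lp_functions p M"
  unfolding Lp_functions_iff_energy
proof
  show "(indicator (\<Union>i\<in>I. F i ` W) :: 'a \<Rightarrow> complex) \<in> borel_measurable M"
    using W_sets assms by (intro borel_measurable_indicator sets.finite_UN) auto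
  have "Lp_energy p M (indicator (\<Union>i\<in>I. F i ` W)) \<le> ennreal (1 powr p) * emeasure M (\<Union>i\<in>I. F i ` W)"
    using W_sets assms by (intro Lp_energy_bounded_support sets.finite_UN) (auto simp: indicator_def)
  also have "\<dots> \<le> (\<Sum>i\<in>I. emeasure M (F i ` W))"
    using W_sets assms by (auto intro!: emeasure_subadditive_finite)
  also have "\<dots> < \<infinity>"
    using orbit_finite assms(2) by (simp add: less_top)
  finally show "Lp_energy p M (indicator (\<Union>i\<in>I. F i ` W)) < \<infinity>" .
qed

section \<open>Necessity of small products\<close>

text \<open>Where the modulus of the approximating function is below 1/2, its distance from the
  value 1 is at least 1/2; by Chebyshev this happens on less than half of the orbit set. The
  remaining set is carried back into \<open>W\<close>, where bounded distortion applies.\<close>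

lemma large_values_near_indicator:
  assumes p: "0 < p" and \<phi> [measurable]: "\<phi> \<in> borel_measurable M"
    and u: "\<And>x. x \<in> F i ` W \<Longrightarrow> u x = 1"
    and approx: "Lp_energy p M (\<lambda>x. c * \<phi> ((f ^^ n) x) - u x) < ennreal d"
    and d: "d \<le> (1/2) powr p * m i / 2"
  shows "\<exists>A\<in>sets M. A \<subseteq> W \<and> m i / 2 \<le> measure M (F i ` A) \<and>
    (\<forall>x\<in>F (int n + i) ` A. 1/2 \<le> norm (c * \<phi> x))"
proof -
  have [measurable]: "W \<in> sets M" by (rule W_sets)
  define B where "B = {x \<in> F i ` W. 1/2 \<le> norm (c * \<phi> ((f ^^ n) x))}"
  define B' where "B' = {x \<in> F i ` W. \<not> 1/2 \<le> norm (c * \<phi> ((f ^^ n) x))}"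
  have "B = F i ` W \<inter> {x \<in> space M. 1/2 \<le> norm (c * \<phi> ((f ^^ n) x))}"
    "B' = F i ` W \<inter> {x \<in> space M. \<not> 1/2 \<le> norm (c * \<phi> ((f ^^ n) x))}"
    by (auto simp: B_def B'_def)
  then have B [measurable]: "B \<in> sets M" and B' [measurable]: "B' \<in> sets M" by auto
  have sub: "B \<subseteq> F i ` W" "B' \<subseteq> F i ` W" by (auto simp: B_def B'_def)
  have "ennreal ((1/2) powr p) * emeasure M B' \<le> Lp_energy p M (\<lambda>x. c * \<phi> ((f ^^ n) x) - u x)"
  proof (rule Lp_energy_Chebyshev)
    fix x assume "x \<in> B'"
    then have "u x = 1" "norm (c * \<phi> ((f ^^ n) x)) < 1/2" by (auto simp: B'_def u)
    then show "1/2 \<le> norm (c * \<phi> ((f ^^ n) x) - u x)"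
      using norm_triangle_ineq2[of "u x" "c * \<phi> ((f ^^ n) x)"] by (simp add: norm_minus_commute)
  qed (use p in auto)
  also note approx
  finally have "(1/2) powr p * measure M B' < d"
    by (simp add: emeasure_sub_orbit[OF B' sub(2)] ennreal_mult[symmetric] ennreal_less_iff)
  then have "(1/2) powr p * measure M B' < (1/2) powr p * (m i / 2)"
    using d unfolding times_divide_eq_right by linarith
  then have "measure M B' < m i / 2"
    by (rule mult_less_cancel_left_pos[THEN iffD1, rotated]) simp
  moreover have "F i ` W = B \<union> B'" by (auto simp: B_def B'_def)
  then have "m i \<le> measure M B + measure M B'"
    by (simp add: m_def measure_Un_le)
  ultimately have half: "m i / 2 \<le> measure M B" by simp
  show ?thesis
  proof (intro bexI[of _ "F (- i) ` B"] conjI)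
    show "F (- i) ` B \<subseteq> W"
      using image_mono[OF sub(1), of "F (- i)"] by (simp add: F_F_image)
    show "\<forall>x\<in>F (int n + i) ` F (- i) ` B. 1/2 \<le> norm (c * \<phi> x)"
      by (auto simp: F_F int_iterate_of_nat B_def)
  qed (use half in \<open>auto simp: F_F_image\<close>)
qed

text \<open>An approximation with error \<open>d\<close> gives a product of at most a constant times
  \<open>d\<close>. The constant depends on \<open>\<phi>\<close> and the system but not on the
  approximation, so \<open>d\<close> can be chosen afterwards.\<close>

lemma function_supercyclic_imp_small_product:
  assumes p: "1 \<le> p" and super: "function_supercyclic p M f" and \<epsilon>: "0 < \<epsilon>"
  shows "\<exists>n::nat. m (int n) * m (- int n) < \<epsilon>"
proof -
  obtain \<phi> where \<phi>: "\<phi> \<in> Lp_functions p M" and dense: "\<And>u e. u \<in> Lp_functions p M \<Longrightarrow> 0 < e \<Longrightarrow>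
     \<exists>n c. Lp_energy p M (\<lambda>x. c * \<phi> ((f ^^ n) x) - u x) < ennreal e"
    using super unfolding function_supercyclic_def by blast
  have \<phi>m [measurable]: "\<phi> \<in> borel_measurable M" and "Lp_energy p M \<phi> < \<infinity>"
    using \<phi> by (auto simp: Lp_functions_iff_energy)
  then obtain P where P: "0 \<le> P" "Lp_energy p M \<phi> = ennreal P"
    by (cases "Lp_energy p M \<phi>") auto
  obtain K where K: "\<And>k B. B \<in> sets M \<Longrightarrow> B \<subseteq> W \<Longrightarrow> m k * measure M B \<le> K * (measure M (F k ` B) * m 0)"
    "\<And>k B. B \<in> sets M \<Longrightarrow> B \<subseteq> W \<Longrightarrow> measure M (F k ` B) * m 0 \<le> K * (m k * measure M B)"
    using distortion by (auto simp: m_def)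
  have "m 0 * m 0 \<le> K * (m 0 * m 0)"
    using K(1)[of W 0] W_sets by (simp add: m_def)
  then have K1: "1 \<le> K"
    using m_pos[of 0] by simp
  obtain C where C: "1 \<le> C" "\<And>k i. m (k + i) \<le> C ^ nat \<bar>i\<bar> * m k"
    using ratio_iterate by blast
  define h where "h = (1/2::real) powr p"
  have h: "0 < h" by (simp add: h_def)

  define Pos where "Pos j \<longleftrightarrow> (\<exists>A\<in>sets M. A \<subseteq> W \<and> 0 < measure M A \<and> (\<exists>\<eta>>0. \<forall>x\<in>F j ` A. \<eta> \<le> norm (\<phi> x)))" for j
  \<comment> \<open>two indices, because an approximation with \<open>n = j\<close> gives no bound on \<open>m (j - n)\<close>\<close>
  have "\<exists>j. Pos j \<and> Pos (j + 1)"
  proof -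
    let ?u = "indicator (\<Union>i\<in>{0,1}. F i ` W) :: 'a \<Rightarrow> complex"
    define d where "d = h * min (m 0) (m 1) / 2"
    have d: "0 < d" using h m_pos by (simp add: d_def)
    obtain n c where nc: "Lp_energy p M (\<lambda>x. c * \<phi> ((f ^^ n) x) - ?u x) < ennreal d"
      using dense[OF indicator_orbit_Lp_functions[of p "{0,1}"] d] p by auto
    have "Pos (int n + i)" if i: "i \<in> {0,1}" for i
    proof -
      have "d \<le> (1/2) powr p * m i / 2"
        using i h by (auto simp: d_def h_def[symmetric])
      then have "\<exists>A\<in>sets M. A \<subseteq> W \<and> m i / 2 \<le> measure M (F i ` A) \<and>
          (\<forall>x\<in>F (int n + i) ` A. 1/2 \<le> norm (c * \<phi> x))"
        by (intro large_values_near_indicator[OF _ \<phi>m _ nc]) (use p i in \<open>auto simp: indicator_def\<close>)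
      then obtain A where A: "A \<in> sets M" "A \<subseteq> W" "m i / 2 \<le> measure M (F i ` A)"
        "\<And>x. x \<in> F (int n + i) ` A \<Longrightarrow> 1/2 \<le> norm (c * \<phi> x)"
        by blast
      \<comment> \<open>The set \<open>A\<close> is known to be large only after transport by
        \<open>F i\<close>; distortion returns positive measure to \<open>A\<close> itself.\<close>
      have "0 < measure M (F i ` A) * m 0"
        using A(3) m_pos[of i] m_pos[of 0] by simp
      also have "\<dots> \<le> K * (m i * measure M A)"
        using K(2) A by auto
      finally have pos: "0 < measure M A"
        using K1 m_pos[of i] by (simp add: zero_less_mult_iff)
      then have "A \<noteq> {}" by auto
      with A(4) have "c \<noteq> 0" by fastforce
      then have "\<forall>x\<in>F (int n + i) ` A. 1 / (2 * norm c) \<le> norm (\<phi> x)" "0 < 1 / (2 * norm c)"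
        using A(4) by (auto simp: norm_mult field_simps)
      with A(1,2) pos show ?thesis unfolding Pos_def by blast
    qed
    from this[of 0] this[of 1] show ?thesis by auto
  qed
  then obtain j where j: "Pos j" "Pos (j + 1)" by blast

  \<comment> \<open>The number \<open>R\<close> has to work for all \<open>n\<close>,
    \<open>c\<close> and \<open>d\<close> at once, so that it is fixed before the tolerance. The
    union over \<open>{0}\<close> is just \<open>W\<close>, in the form in which indicators were
    shown to lie in the space.\<close>
  define bound where "bound i R \<longleftrightarrow> (\<forall>n c d. int n \<noteq> i \<longrightarrow> 0 < d \<longrightarrow> d \<le> h * m 0 / 2 \<longrightarrow>
      Lp_energy p M (\<lambda>x. c * \<phi> ((f ^^ n) x) - indicator (\<Union>i\<in>{0}. F i ` W) x) < ennreal d \<longrightarrow>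
      m (int n) * m (- int n) \<le> R * d)" for i and R :: real
  have key: "\<exists>R\<ge>0. bound i R" if i: "Pos i" for i
  proof -
    obtain A \<eta> where A: "A \<in> sets M" "A \<subseteq> W" "0 < measure M A" and \<eta>: "0 < \<eta>"
      "\<And>x. x \<in> F i ` A \<Longrightarrow> \<eta> \<le> norm (\<phi> x)"
      using i by (auto simp: Pos_def)
    define S where "S = h / 2 * (\<eta> powr p * measure M A)"
    have S: "0 < S" using h \<eta> A by (simp add: S_def)
    define R where "R = C ^ nat \<bar>i\<bar> * (K * P * (K * m 0)) / S"
    show ?thesis
      unfolding bound_def
    proof (intro exI[of _ R] conjI allI impI)
      show "0 \<le> R" using C K1 P S m_pos[of 0] by (auto simp: R_def)
      fix n c d assume n: "int n \<noteq> i" and d: "0 < d" "d \<le> h * m 0 / 2"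
        and nc: "Lp_energy p M (\<lambda>x. c * \<phi> ((f ^^ n) x) - indicator (\<Union>i\<in>{0}. F i ` W) x) < ennreal d"
      define g where "g = norm c powr p"
      obtain A' where A': "A' \<in> sets M" "A' \<subseteq> W" "m 0 / 2 \<le> measure M A'"
        "\<And>x. x \<in> F (int n) ` A' \<Longrightarrow> 1/2 \<le> norm (c * \<phi> x)"
      proof -
        have "\<exists>A\<in>sets M. A \<subseteq> W \<and> m 0 / 2 \<le> measure M (F 0 ` A) \<and>
            (\<forall>x\<in>F (int n + 0) ` A. 1/2 \<le> norm (c * \<phi> x))"
          by (rule large_values_near_indicator[OF _ \<phi>m _ nc]) (use p d in \<open>auto simp: h_def\<close>)
        then show thesis
          using that by (simp only: add_0_right int_iterate_0 image_id id_apply) blast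
      qed
      have "A' \<noteq> {}" using A'(3) m_pos[of 0] by auto
      then have c: "c \<noteq> 0" using A'(4) by fastforce
      then have g: "0 < g" by (simp add: g_def)
      have FA': "F (int n) ` A' \<in> sets M" "F (int n) ` A' \<subseteq> F (int n) ` W"
        using A' by (auto intro: sets_F_image)
      \<comment> \<open>The large values of \<open>c * \<phi>\<close> on the image of
        \<open>A'\<close> are paid for by its total energy \<open>g * P\<close>. This bounds
        \<open>m n\<close> by a multiple of the unknown factor \<open>g\<close>.\<close>
      have "ennreal h * emeasure M (F (int n) ` A') \<le> Lp_energy p M (\<lambda>x. c * \<phi> x)"
        unfolding h_def using p A'(4) FA'(1) by (intro Lp_energy_Chebyshev) auto
      also have "\<dots> = ennreal (g * P)"
        using P by (simp add: Lp_energy_scale g_def ennreal_mult)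
      finally have 1: "h * measure M (F (int n) ` A') \<le> g * P"
        using h g P by (simp add: emeasure_sub_orbit[OF FA'] ennreal_mult[symmetric])
      have "m (int n) * (m 0 / 2) \<le> m (int n) * measure M A'"
        using A' m_pos[of "int n"] by simp
      also have "\<dots> \<le> K * (measure M (F (int n) ` A') * m 0)"
        using K(1) A' by auto
      finally have 2: "m (int n) / 2 \<le> K * measure M (F (int n) ` A')"
        using m_pos[of 0] by (simp add: field_simps)
      have a: "h * (m (int n) / 2) \<le> K * (g * P)"
      proof -
        have "h * (m (int n) / 2) \<le> h * (K * measure M (F (int n) ` A'))"
          using 2 h by simp
        also have "\<dots> = K * (h * measure M (F (int n) ` A'))" by simp
        also have "\<dots> \<le> K * (g * P)" using 1 K1 by simp
        finally show ?thesis .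
      qed

      let ?A = "F (i - int n) ` A"
      have FA: "?A \<in> sets M" "?A \<subseteq> F (i - int n) ` W"
        using A by (auto intro: sets_F_image)
      \<comment> \<open>Here \<open>int n \<noteq> i\<close> enters: the set \<open>?A\<close> lies
        off \<open>W\<close>, where the target vanishes, so the values of the approximating function
        there are pure error.\<close>
      have disj: "F (i - int n) ` W \<inter> F 0 ` W = {}"
        using W_disjoint n by (intro disjoint_family_onD[of _ UNIV]) auto
      have "ennreal ((norm c * \<eta>) powr p) * emeasure M ?A
          \<le> Lp_energy p M (\<lambda>x. c * \<phi> ((f ^^ n) x) - indicator (\<Union>i\<in>{0}. F i ` W) x)"
      proof (rule Lp_energy_Chebyshev)
        fix x assume x: "x \<in> ?A"
        then have "(f ^^ n) x \<in> F i ` A"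
          by (auto simp: int_iterate_of_nat[symmetric] F_F)
        moreover have "x \<notin> (\<Union>i\<in>{0}. F i ` W)"
          using x FA(2) disj by auto
        ultimately show "norm c * \<eta> \<le> norm (c * \<phi> ((f ^^ n) x) - indicator (\<Union>i\<in>{0}. F i ` W) x)"
          using \<eta>(2) by (simp add: norm_mult mult_left_mono)
      qed (use p FA \<eta> in auto)
      also note nc
      finally have 3: "g * \<eta> powr p * measure M ?A < d"
        using \<eta> by (simp add: emeasure_sub_orbit[OF FA] ennreal_mult[symmetric] ennreal_less_iff powr_mult g_def)
      have 4: "m (i - int n) * measure M A \<le> K * (measure M ?A * m 0)"
        using K(1) A by auto
      have b: "g * \<eta> powr p * (m (i - int n) * measure M A) \<le> K * m 0 * d"
      proof -
        have "g * \<eta> powr p * (m (i - int n) * measure M A) \<le> g * \<eta> powr p * (K * (measure M ?A * m 0))"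
          using 4 g by (intro mult_left_mono) auto
        also have "\<dots> = K * m 0 * (g * \<eta> powr p * measure M ?A)" by simp
        also have "\<dots> \<le> K * m 0 * d"
          using 3 K1 m_pos[of 0] by (intro mult_left_mono) auto
        finally show ?thesis .
      qed

      \<comment> \<open>In \<open>a\<close> the factor \<open>g\<close> stands on the right, in
        \<open>b\<close> on the left, so it cancels from the product.\<close>
      have "(h * (m (int n) / 2)) * (g * \<eta> powr p * (m (i - int n) * measure M A)) \<le> (K * (g * P)) * (K * m 0 * d)"
        using h g K1 P m_pos[of "int n"] m_pos[of "i - int n"] A by (intro mult_mono[OF a b]) auto
      then have "g * (S * (m (int n) * m (i - int n))) \<le> g * (K * P * (K * m 0) * d)"
        by (simp add: S_def mult_ac)
      then have "S * (m (int n) * m (i - int n)) \<le> K * P * (K * m 0) * d"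
        using g by simp
      then have 5: "m (int n) * m (i - int n) \<le> K * P * (K * m 0) * d / S"
        using S by (simp add: field_simps)
      \<comment> \<open>Returns from the index \<open>i - n\<close> to \<open>- n\<close>; the price
        depends on \<open>i\<close> alone.\<close>
      have "m (- int n) \<le> C ^ nat \<bar>i\<bar> * m (i - int n)"
        using C(2)[of "i - int n" "- i"] by simp
      then have "m (int n) * m (- int n) \<le> C ^ nat \<bar>i\<bar> * (m (int n) * m (i - int n))"
        using m_pos[of "int n"] by (simp add: mult_ac)
      also have "\<dots> \<le> C ^ nat \<bar>i\<bar> * (K * P * (K * m 0) * d / S)"
        using 5 C by (intro mult_left_mono) auto
      finally show "m (int n) * m (- int n) \<le> R * d"
        by (simp add: R_def mult_ac)
    qed
  qed

  obtain R1 R2 where R: "0 \<le> R1" "0 \<le> R2" and R1: "bound j R1" and R2: "bound (j + 1) R2"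
    using key[OF j(1)] key[OF j(2)] by blast
  \<comment> \<open>Both constants enter because \<open>n\<close> may coincide with one of
    \<open>j\<close> and \<open>j + 1\<close>, and it is not known which. The summand 1 keeps the
    divisor positive and makes the final inequality strict.\<close>
  define d where "d = min (h * m 0 / 2) (\<epsilon> / (R1 + R2 + 1))"
  have d: "0 < d" "d \<le> h * m 0 / 2" "d \<le> \<epsilon> / (R1 + R2 + 1)"
    using h \<epsilon> R m_pos[of 0] unfolding d_def by (simp, linarith, linarith)
  obtain n c where nc: "Lp_energy p M (\<lambda>x. c * \<phi> ((f ^^ n) x) - indicator (\<Union>i\<in>{0}. F i ` W) x) < ennreal d"
    using dense[OF indicator_orbit_Lp_functions[of p "{0}"] d(1)] p by auto
  have "m (int n) * m (- int n) \<le> (R1 + R2) * d"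
  proof (cases "int n = j")
    case True
    then have "m (int n) * m (- int n) \<le> R2 * d"
      using R2[unfolded bound_def, rule_format, OF _ d(1,2) nc] by simp
    also have "\<dots> \<le> (R1 + R2) * d" using R d(1) by (intro mult_right_mono) auto
    finally show ?thesis .
  next
    case False
    then have "m (int n) * m (- int n) \<le> R1 * d"
      using R1[unfolded bound_def, rule_format, OF _ d(1,2) nc] by simp
    also have "\<dots> \<le> (R1 + R2) * d" using R d(1) by (intro mult_right_mono) auto
    finally show ?thesis .
  qed
  also have "\<dots> < (R1 + R2 + 1) * d"
    using d by simp
  also have "\<dots> \<le> \<epsilon>"
    using d(3) R by (simp add: field_simps)
  finally show ?thesis by blast
qed

end

section \<open>Sufficiency: construction of a supercyclic vector\<close>

text \<open>At each point at most one summand is nonzero, so the p-th power passes through the sum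
  and no factors \<open>2 powr p\<close> accumulate over infinitely many terms.\<close>

lemma Lp_energy_suminf_disjoint:
  assumes p: "0 < p" and [measurable]: "\<And>l. v l \<in> borel_measurable M"
    and disj: "\<And>x l k. v l x \<noteq> 0 \<Longrightarrow> v k x \<noteq> 0 \<Longrightarrow> l = (k::nat)"
  shows "Lp_energy p M (\<lambda>x. \<Sum>l. v l x) \<le> (\<Sum>l. Lp_energy p M (v l))"
proof -
  have "ennreal (norm (\<Sum>l. v l x) powr p) \<le> (\<Sum>l. ennreal (norm (v l x) powr p))" for x
  proof (cases "\<exists>k. v k x \<noteq> 0")
    case True
    then obtain k where k: "v k x \<noteq> 0" by blast
    then have "(\<Sum>l. v l x) = (\<Sum>l\<in>{k}. v l x)"
      by (intro suminf_finite) (use disj in auto)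
    then have "ennreal (norm (\<Sum>l. v l x) powr p) = (\<Sum>l\<in>{k}. ennreal (norm (v l x) powr p))"
      by simp
    also have "\<dots> \<le> (\<Sum>l. ennreal (norm (v l x) powr p))"
      by (intro sum_le_suminf) auto
    finally show ?thesis .
  qed (use p in auto)
  then show ?thesis
    unfolding Lp_energy_def by (subst nn_integral_suminf[symmetric]) (auto intro!: nn_integral_mono)
qed

text \<open>Both sums have at most one nonzero term. The lemma separates the term that reproduces
  the target from the errors.\<close>

lemma suminf_split_disjoint:
  fixes v :: "nat \<Rightarrow> complex"
  assumes "\<And>l j. v l \<noteq> 0 \<Longrightarrow> v j \<noteq> 0 \<Longrightarrow> l = j"
  shows "(\<Sum>l. v l) - v k = (\<Sum>l. if l = k then 0 else v l)"
proof (cases "\<exists>j. v j \<noteq> 0")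
  case True
  then obtain j where j: "v j \<noteq> 0" by blast
  have *: "v l = 0" if "l \<noteq> j" for l using assms[OF _ j] that by blast
  then have "(\<Sum>l. v l) = (\<Sum>l\<in>{j}. v l)" "(\<Sum>l. if l = k then 0 else v l) = (\<Sum>l\<in>{j}. if l = k then 0 else v l)"
    by (intro suminf_finite; auto)+
  with * show ?thesis by auto
qed (simp cong: if_cong)

context wandering_system
begin

text \<open>Applying the iterate \<open>n k\<close> and dividing by \<open>a k\<close> turns the
  \<open>k\<close>-th term of \<open>\<phi>\<close> into \<open>h k\<close> exactly. Any other term
  \<open>l\<close> becomes an error of energy at most
  \<open>\<alpha> l / \<alpha> k * \<Gamma> l * m (n l - n k)\<close>. Up to constants of the
  earlier stages, this is \<open>m (- n k) / \<alpha> k\<close> for \<open>l < k\<close> and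
  \<open>\<alpha> l * m (n l)\<close> for \<open>l > k\<close>; both must be small.\<close>

theorem small_product_imp_function_supercyclic:
  assumes p: "1 \<le> p" and small: "\<And>\<epsilon>. 0 < \<epsilon> \<Longrightarrow> \<exists>n::nat. m (int n) * m (- int n) < \<epsilon>"
  shows "function_supercyclic p M f"
proof -
  obtain H :: "nat \<Rightarrow> 'a \<Rightarrow> complex" and b0 :: "nat \<Rightarrow> real" and q0 :: "nat \<Rightarrow> nat"
    where H: "\<And>l. H l \<in> borel_measurable M" "\<And>l x. norm (H l x) \<le> b0 l"
    "\<And>l x. H l x \<noteq> 0 \<Longrightarrow> \<exists>i. \<bar>i\<bar> \<le> int (q0 l) \<and> x \<in> F i ` W"
    and dense: "\<And>u e. u \<in> Lp_functions p M \<Longrightarrow> 0 < e \<Longrightarrow> \<exists>l. Lp_energy p M (\<lambda>x. H l x - u x) < ennreal e"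
    by (rule Lp_functions_dense_sequence[OF p sets_gen sets_F_image[OF W_sets] orbit_finite W_cover
        W_disjoint countable_G], rule that)
  obtain C where C: "1 \<le> C" "\<And>k i. m (k + i) \<le> C ^ nat \<bar>i\<bar> * m k"
    using ratio_iterate by blast

  \<comment> \<open>every \<open>H i\<close> is repeated infinitely often\<close>
  define h where "h k = H (fst (prod_decode k))" for k
  define b where "b k = b0 (fst (prod_decode k))" for k
  define q where "q k = q0 (fst (prod_decode k))" for k
  have h [measurable]: "\<And>k. h k \<in> borel_measurable M" and hb: "\<And>k x. norm (h k x) \<le> b k"
    and supp: "\<And>k x. h k x \<noteq> 0 \<Longrightarrow> \<exists>i. \<bar>i\<bar> \<le> int (q k) \<and> x \<in> F i ` W"
    using H by (simp_all add: h_def b_def q_def)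
  \<comment> \<open>The support of \<open>h k\<close> meets at most \<open>2 * q k + 1\<close> orbit
    sets, and each is comparable to the central one within \<open>C ^ q k\<close>. The last summand
    makes \<open>\<Gamma>\<close> positive.\<close>
  define \<Gamma> where "\<Gamma> k = b k powr p * ((2 * q k + 1) * C ^ q k) + 1" for k
  have \<Gamma>: "0 < \<Gamma> k" for k
    using C by (auto simp: \<Gamma>_def intro!: add_nonneg_pos)

  have supp_F: "\<exists>i. \<bar>i\<bar> \<le> int (q k) \<and> x \<in> F (i - s) ` W" if nz: "h k (F s x) \<noteq> 0" for k s x
  proof -
    obtain i where i: "\<bar>i\<bar> \<le> int (q k)" "F s x \<in> F i ` W"
      using supp[OF nz] by blast
    have "F (- s) (F s x) \<in> F (- s) ` F i ` W" using i(2) by (rule imageI)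
    then have "x \<in> F (i - s) ` W" by (simp only: F_F F_F_image) simp
    with i(1) show ?thesis by blast
  qed
  have energy: "Lp_energy p M (\<lambda>x. h k (F s x)) \<le> ennreal (\<Gamma> k * m (- s))" for k s
  proof -
    let ?I = "{- int (q k)..int (q k)}"
    let ?A = "\<Union>i\<in>?I. F (i - s) ` W"
    have "emeasure M ?A \<le> (\<Sum>i\<in>?I. emeasure M (F (i - s) ` W))"
      using W_sets by (intro emeasure_subadditive_finite) auto
    also have "\<dots> \<le> (\<Sum>i\<in>?I. ennreal (C ^ q k * m (- s)))"
    proof (rule sum_mono)
      fix i assume "i \<in> ?I"
      then have "C ^ nat \<bar>i\<bar> \<le> C ^ q k"
        using C(1) by (auto intro!: power_increasing)
      moreover have "m (i - s) \<le> C ^ nat \<bar>i\<bar> * m (- s)"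
        using C(2)[of "- s" i] by simp
      ultimately have "m (i - s) \<le> C ^ q k * m (- s)"
        using m_pos[of "- s"] by (meson less_imp_le mult_right_mono order_trans)
      then show "emeasure M (F (i - s) ` W) \<le> ennreal (C ^ q k * m (- s))"
        by (simp add: emeasure_orbit ennreal_leI)
    qed
    also have "\<dots> = ennreal (\<Sum>i\<in>?I. C ^ q k * m (- s))"
      using C(1) m_pos[of "- s"] by (intro sum_ennreal) auto
    also have "(\<Sum>i\<in>?I. C ^ q k * m (- s)) = (2 * q k + 1) * C ^ q k * m (- s)"
      by (simp add: nat_add_distrib)
    finally have A: "emeasure M ?A \<le> ennreal ((2 * q k + 1) * C ^ q k * m (- s))" .
    have "Lp_energy p M (\<lambda>x. h k (F s x)) \<le> ennreal (b k powr p) * emeasure M ?A"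
    proof (rule Lp_energy_bounded_support)
      show "?A \<in> sets M" using W_sets by (intro sets.finite_UN) auto
      show "h k (F s x) = 0" if "x \<notin> ?A" for x
        using supp_F[of k s x] that by (force simp: abs_le_iff)
    qed (use p hb in auto)
    also have "\<dots> \<le> ennreal (b k powr p) * ennreal ((2 * q k + 1) * C ^ q k * m (- s))"
      by (intro mult_left_mono A) auto
    also have "\<dots> = ennreal (b k powr p * ((2 * q k + 1) * C ^ q k) * m (- s))"
      using C m_pos[of "- s"] by (simp add: ennreal_mult[symmetric] mult.assoc)
    also have "\<dots> \<le> ennreal (\<Gamma> k * m (- s))"
      using m_pos[of "- s"] by (intro ennreal_leI mult_right_mono) (auto simp: \<Gamma>_def)
    finally show ?thesis .
  qed

  \<comment> \<open>A pair consists of \<open>\<alpha>\<close>, the p-th power of the modulus of the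
    coefficient, and the exponent \<open>n\<close>. The clauses after positivity give convergence of
    the series, disjoint supports, and smallness of the errors between \<open>k\<close> and each
    earlier \<open>l\<close> in both directions. The weight \<open>(1/2) ^ (k + l)\<close> is
    symmetric and summable in either index.\<close>
  define P :: "(nat \<Rightarrow> real \<times> nat) \<Rightarrow> nat \<Rightarrow> real \<times> nat \<Rightarrow> bool" where
    "P g k r \<longleftrightarrow> 0 < fst r \<and> fst r * (\<Gamma> k * m (int (snd r))) \<le> (1/2) ^ k \<and>
       (\<forall>l<k. snd (g l) + q l + q k < snd r \<and>
          fst r * (\<Gamma> k * m (int (snd r) - int (snd (g l)))) \<le> (1/2) ^ (k + l) * fst (g l) \<and>
          fst (g l) * (\<Gamma> l * m (int (snd (g l)) - int (snd r))) \<le> (1/2) ^ (k + l) * fst r)" for g k r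
  have "\<exists>g. \<forall>k. P g k (g k)"
  \<comment> \<open>Each pair depends on all earlier ones. \<open>P g k\<close> looks at
    \<open>g\<close> only below \<open>k\<close>, as this form of choice requires.\<close>
  proof (rule dependent_wf_choice[of less_than])
    fix k and g :: "nat \<Rightarrow> real \<times> nat" assume "\<And>l. (l, k) \<in> less_than \<Longrightarrow> P g l (g l)"
    then have pos: "0 < fst (g l)" if "l < k" for l
      using that by (auto simp: P_def)
    have small_mult: "\<forall>\<^sub>F \<epsilon> in at_right (0::real). \<epsilon> * X \<le> Y" if "0 < Y" for X Y
    proof -
      have "((\<lambda>\<epsilon>. \<epsilon> * X) \<longlongrightarrow> 0 * X) (at_right 0)" by (intro tendsto_intros)
      then have "\<forall>\<^sub>F \<epsilon> in at_right (0::real). \<epsilon> * X < Y" using that by (intro order_tendstoD(2)) auto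
      then show ?thesis by eventually_elim simp
    qed
    \<comment> \<open>Finitely many constraints, each true for all small positive
      \<open>\<epsilon>\<close>. This number will bound both \<open>\<alpha> * m n\<close> and
      \<open>m (- n) / \<alpha>\<close>.\<close>
    have "\<forall>\<^sub>F \<epsilon> in at_right (0::real). 0 < \<epsilon> \<and> \<epsilon> * \<Gamma> k \<le> (1/2) ^ k \<and>
        (\<forall>l\<in>{..<k}. \<epsilon> * (\<Gamma> k * C ^ snd (g l)) \<le> (1/2) ^ (k + l) * fst (g l) \<and>
               \<epsilon> * (fst (g l) * \<Gamma> l * C ^ snd (g l)) \<le> (1/2) ^ (k + l))"
      using pos by (intro eventually_conj eventually_ball_finite small_mult ballI eventually_at_right_less) auto
    then obtain \<epsilon> :: real where \<epsilon>: "0 < \<epsilon>" "\<epsilon> * \<Gamma> k \<le> (1/2) ^ k"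
        "\<And>l. l < k \<Longrightarrow> \<epsilon> * (\<Gamma> k * C ^ snd (g l)) \<le> (1/2) ^ (k + l) * fst (g l)"
        "\<And>l. l < k \<Longrightarrow> \<epsilon> * (fst (g l) * \<Gamma> l * C ^ snd (g l)) \<le> (1/2) ^ (k + l)"
      using eventually_happens'[OF trivial_limit_at_right_real] by (metis (no_types, lifting) lessThan_iff)
    define N where "N = (\<Sum>l<k. snd (g l) + q l + q k)"
    have N: "snd (g l) + q l + q k \<le> N" if "l < k" for l
      unfolding N_def using that by (intro member_le_sum) auto
    \<comment> \<open>The minimum runs over the products for all exponents up to \<open>N\<close>,
      so a product below it forces an exponent beyond \<open>N\<close>.\<close>
    define \<delta> where "\<delta> = min (\<epsilon>\<^sup>2) (Min ((\<lambda>n. m (int n) * m (- int n)) ` {..N}))"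
    have "0 < \<delta>" using \<epsilon>(1) m_pos by (auto simp: \<delta>_def)
    then obtain n where n: "m (int n) * m (- int n) < \<delta>" using small by blast
    have "N < n"
    proof (rule ccontr)
      assume "\<not> N < n"
      then have "Min ((\<lambda>n. m (int n) * m (- int n)) ` {..N}) \<le> m (int n) * m (- int n)"
        by (intro Min_le) auto
      moreover have "\<delta> \<le> Min ((\<lambda>n. m (int n) * m (- int n)) ` {..N})"
        unfolding \<delta>_def by (rule min.cobounded2)
      ultimately show False using n by linarith
    qed
    \<comment> \<open>This choice equates \<open>\<alpha> * m n\<close> with
      \<open>m (- n) / \<alpha>\<close>; the common value is the square root of the product, which
      is below \<open>\<epsilon>\<close>.\<close>
    define \<alpha> where "\<alpha> = sqrt (m (- int n) / m (int n))"
    have \<alpha>: "0 < \<alpha>" "\<alpha>\<^sup>2 * m (int n) = m (- int n)"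
      using m_pos[of "int n"] m_pos[of "- int n"] by (auto simp: \<alpha>_def)
    have "(\<alpha> * m (int n))\<^sup>2 = m (int n) * m (- int n)"
      using \<alpha>(2) by (simp add: power2_eq_square mult_ac)
    also have "\<dots> < \<epsilon>\<^sup>2" using n by (simp add: \<delta>_def)
    finally have 1: "\<alpha> * m (int n) \<le> \<epsilon>"
      using \<epsilon>(1) by (meson less_imp_le power2_le_imp_le)
    have 2: "m (- int n) \<le> \<epsilon> * \<alpha>"
    proof -
      have "m (- int n) = \<alpha> * (\<alpha> * m (int n))"
        using \<alpha>(2) by (simp add: power2_eq_square mult.assoc)
      also have "\<dots> \<le> \<alpha> * \<epsilon>" using 1 \<alpha>(1) by (intro mult_left_mono) auto
      finally show ?thesis by (simp add: mult.commute)
    qed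
    have "P g k (\<alpha>, n)"
      unfolding P_def fst_conv snd_conv
    proof (intro conjI allI impI)
      have "\<alpha> * (\<Gamma> k * m (int n)) \<le> \<epsilon> * \<Gamma> k"
        using mult_right_mono[OF 1 less_imp_le[OF \<Gamma>[of k]]] by (simp only: mult_ac)
      also note \<epsilon>(2)
      finally show "\<alpha> * (\<Gamma> k * m (int n)) \<le> (1/2) ^ k" .
    next
      fix l assume l: "l < k"
      show "snd (g l) + q l + q k < n" using N[OF l] \<open>N < n\<close> by simp
      \<comment> \<open>The exponent of stage \<open>l\<close> is already fixed, so shifting by it
        costs a constant that was taken into account in the choice of
        \<open>\<epsilon>\<close>.\<close>
      have "\<alpha> * (\<Gamma> k * m (int n - int (snd (g l)))) \<le> \<alpha> * (\<Gamma> k * (C ^ snd (g l) * m (int n)))"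
        using C(2)[of "int n" "- int (snd (g l))"] \<alpha> \<Gamma>[of k] by (auto intro!: mult_left_mono)
      also have "\<dots> = \<Gamma> k * C ^ snd (g l) * (\<alpha> * m (int n))" by simp
      also have "\<dots> \<le> \<Gamma> k * C ^ snd (g l) * \<epsilon>"
        using C \<Gamma>[of k] by (intro mult_left_mono 1) auto
      also have "\<dots> \<le> (1/2) ^ (k + l) * fst (g l)" using \<epsilon>(3)[OF l] by (simp add: mult_ac)
      finally show "\<alpha> * (\<Gamma> k * m (int n - int (snd (g l)))) \<le> (1/2) ^ (k + l) * fst (g l)" .
      have "fst (g l) * (\<Gamma> l * m (int (snd (g l)) - int n)) \<le> fst (g l) * (\<Gamma> l * (C ^ snd (g l) * m (- int n)))"
        using C(2)[of "- int n" "int (snd (g l))"] pos[OF l] \<Gamma>[of l] by (auto intro!: mult_left_mono)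
      also have "\<dots> = fst (g l) * \<Gamma> l * C ^ snd (g l) * m (- int n)" by simp
      also have "\<dots> \<le> fst (g l) * \<Gamma> l * C ^ snd (g l) * (\<epsilon> * \<alpha>)"
        using C \<Gamma>[of l] pos[OF l] by (intro mult_left_mono 2) auto
      also have "\<dots> = \<epsilon> * (fst (g l) * \<Gamma> l * C ^ snd (g l)) * \<alpha>" by simp
      also have "\<dots> \<le> (1/2) ^ (k + l) * \<alpha>"
        using \<alpha>(1) by (intro mult_right_mono \<epsilon>(4)[OF l]) auto
      finally show "fst (g l) * (\<Gamma> l * m (int (snd (g l)) - int n)) \<le> (1/2) ^ (k + l) * \<alpha>" .
    qed (rule \<alpha>(1))
    then show "\<exists>r. P g k r" by blast
  qed (auto simp: P_def)
  then obtain g where g: "\<And>k. P g k (g k)" by blast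
  define \<alpha> n where "\<alpha> k = fst (g k)" and "n k = snd (g k)" for k
  have \<alpha>: "0 < \<alpha> k" for k
    using g[of k] by (auto simp: P_def \<alpha>_def)
  have start: "\<alpha> k * (\<Gamma> k * m (int (n k))) \<le> (1/2) ^ k" for k
    using g[of k] by (auto simp: P_def \<alpha>_def n_def)
  have gap: "n l + q l + q k < n k" if "l < k" for k l
    using g[of k] that by (auto simp: P_def \<alpha>_def n_def)
  \<comment> \<open>The last two clauses of \<open>P\<close>, read at the larger of the two indices,
    combine into one inequality for either order of \<open>l\<close> and \<open>k\<close>.\<close>
  have cross: "\<alpha> l * (\<Gamma> l * m (int (n l) - int (n k))) \<le> (1/2) ^ (k + l) * \<alpha> k" if "l \<noteq> k" for k l
    using g[of k] g[of l] that by (cases l k rule: linorder_cases) (auto simp: P_def \<alpha>_def n_def add.commute)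

  \<comment> \<open>The root is taken because \<open>\<alpha>\<close> multiplies energies, not
    norms.\<close>
  define a where "a k = complex_of_real (\<alpha> k powr (1 / p))" for k
  have a: "a k \<noteq> 0" "norm (a k) powr p = \<alpha> k" for k
    using \<alpha>[of k] p by (auto simp: a_def powr_powr)
  have disj: "l = k" if "a l * h l (F (- int (n l)) x) \<noteq> 0" "a k * h k (F (- int (n k)) x) \<noteq> 0" for l k x
  proof -
    have nz: "h l (F (- int (n l)) x) \<noteq> 0" "h k (F (- int (n k)) x) \<noteq> 0"
      using that by auto
    obtain i where i: "\<bar>i\<bar> \<le> int (q l)" "x \<in> F (i + int (n l)) ` W"
      using supp_F[OF nz(1)] unfolding diff_minus_eq_add by blast
    obtain j where j: "\<bar>j\<bar> \<le> int (q k)" "x \<in> F (j + int (n k)) ` W"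
      using supp_F[OF nz(2)] unfolding diff_minus_eq_add by blast
    \<comment> \<open>Orbit sets with different indices are disjoint. The index windows of different
      terms are kept apart by \<open>gap\<close>.\<close>
    have "i + int (n l) = j + int (n k)"
      using W_disjoint i(2) j(2) by (auto simp: disjoint_family_on_def)
    then show "l = k"
      using gap[of l k] gap[of k l] i(1) j(1) by (cases l k rule: linorder_cases) auto
  qed
  define \<phi> where "\<phi> x = (\<Sum>l. a l * h l (F (- int (n l)) x))" for x
  have [measurable]: "\<phi> \<in> borel_measurable M"
    unfolding \<phi>_def by measurable
  have sums: "(\<Sum>l. ennreal ((1/2) ^ (k + l))) = ennreal (2 * (1/2) ^ k)" for k
    using sums_mult[OF geometric_sums[of "1/2::real"], of "(1/2) ^ k"]
    by (intro suminf_ennreal_eq) (auto simp: power_add mult.commute)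
  have "Lp_energy p M \<phi> \<le> (\<Sum>l. Lp_energy p M (\<lambda>x. a l * h l (F (- int (n l)) x)))"
    unfolding \<phi>_def using p disj by (intro Lp_energy_suminf_disjoint) auto
  also have "\<dots> \<le> (\<Sum>l. ennreal ((1/2) ^ (0 + l)))"
  proof (intro suminf_le allI)
    fix l
    have "Lp_energy p M (\<lambda>x. a l * h l (F (- int (n l)) x)) \<le> ennreal (\<alpha> l) * ennreal (\<Gamma> l * m (int (n l)))"
      using energy[of l "- int (n l)"] by (auto simp: Lp_energy_scale a intro!: mult_left_mono)
    also have "\<dots> \<le> ennreal ((1/2) ^ (0 + l))"
      using start[of l] \<alpha>[of l] \<Gamma>[of l] m_pos[of "int (n l)"] by (auto simp: ennreal_mult[symmetric] intro!: ennreal_leI)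
    finally show "Lp_energy p M (\<lambda>x. a l * h l (F (- int (n l)) x)) \<le> ennreal ((1/2) ^ (0 + l))" .
  qed auto
  also have "\<dots> < \<infinity>" unfolding sums by simp
  finally have \<phi>: "\<phi> \<in> Lp_functions p M"
    by (simp add: Lp_functions_iff_energy)

  have approx: "Lp_energy p M (\<lambda>x. (1 / a k) * \<phi> ((f ^^ n k) x) - h k x) \<le> ennreal (2 * (1/2) ^ k)" for k
  proof -
    define v where "v l x = a l / a k * h l (F (int (n k) - int (n l)) x)" for l x
    have v_eq: "v l x = (1 / a k) * (a l * h l (F (- int (n l)) (F (int (n k)) x)))" for l x
      by (simp add: v_def F_F)
    have v_disj: "l = j" if "v l x \<noteq> 0" "v j x \<noteq> 0" for l j x
      by (rule disj[of l "F (int (n k)) x" j]) (use that in \<open>auto simp only: v_eq mult_eq_0_iff\<close>)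
    have vk: "v k x = h k x" for x by (simp add: v_def a)
    \<comment> \<open>Needed for moving the factor \<open>1 / a k\<close> into the series; at every
      point at most one term is nonzero.\<close>
    have summable: "summable (\<lambda>l. a l * h l (F (- int (n l)) y))" for y
    proof (cases "\<exists>j. a j * h j (F (- int (n j)) y) \<noteq> 0")
      case True
      then obtain j where "a j * h j (F (- int (n j)) y) \<noteq> 0" by blast
      then have "a l * h l (F (- int (n l)) y) = 0" if "l \<notin> {j}" for l
        using disj[of l y j] that by blast
      then show ?thesis
        by (intro summable_finite[of "{j}"]) auto
    next
      case False
      then have "(\<lambda>l. a l * h l (F (- int (n l)) y)) = (\<lambda>l. 0)" by blast
      then show ?thesis by (simp only: summable_zero)
    qed
    have "(1 / a k) * \<phi> ((f ^^ n k) x) = (\<Sum>l. v l x)" for x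
      unfolding \<phi>_def v_eq int_iterate_of_nat[symmetric] by (intro suminf_mult[symmetric] summable)
    then have "(1 / a k) * \<phi> ((f ^^ n k) x) - h k x = (\<Sum>l. if l = k then 0 else v l x)" for x
      using suminf_split_disjoint[of "\<lambda>l. v l x" k] v_disj by (simp add: vk)
    then have "Lp_energy p M (\<lambda>x. (1 / a k) * \<phi> ((f ^^ n k) x) - h k x)
        = Lp_energy p M (\<lambda>x. \<Sum>l. if l = k then 0 else v l x)"
      by simp
    also have "\<dots> \<le> (\<Sum>l. Lp_energy p M (\<lambda>x. if l = k then 0 else v l x))"
    proof (rule Lp_energy_suminf_disjoint)
      have [measurable]: "v l \<in> borel_measurable M" for l
        unfolding v_def[abs_def] by measurable
      show "(\<lambda>x. if l = k then 0 else v l x) \<in> borel_measurable M" for l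
        by measurable
    qed (use p v_disj in \<open>auto split: if_splits\<close>)
    also have "\<dots> \<le> (\<Sum>l. ennreal ((1/2) ^ (k + l)))"
    proof (intro suminf_le allI)
      fix l
      show "Lp_energy p M (\<lambda>x. if l = k then 0 else v l x) \<le> ennreal ((1/2) ^ (k + l))"
      proof (cases "l = k")
        case False
        have "Lp_energy p M (v l) =
            ennreal (norm (a l / a k) powr p) * Lp_energy p M (\<lambda>x. h l (F (int (n k) - int (n l)) x))"
          unfolding v_def[abs_def] by (rule Lp_energy_scale) measurable
        also have "norm (a l / a k) powr p = \<alpha> l / \<alpha> k"
          by (simp add: norm_divide powr_divide a)
        also have "ennreal (\<alpha> l / \<alpha> k) * Lp_energy p M (\<lambda>x. h l (F (int (n k) - int (n l)) x))
            \<le> ennreal (\<alpha> l / \<alpha> k) * ennreal (\<Gamma> l * m (int (n l) - int (n k)))"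
          using energy[of l "int (n k) - int (n l)"] by (intro mult_left_mono) auto
        also have "\<dots> = ennreal (\<alpha> l * (\<Gamma> l * m (int (n l) - int (n k))) / \<alpha> k)"
          using \<alpha>[of l] \<alpha>[of k] \<Gamma>[of l] m_pos[of "int (n l) - int (n k)"] by (simp add: ennreal_mult[symmetric])
        also have "\<dots> \<le> ennreal ((1/2) ^ (k + l))"
          using cross[OF False] \<alpha>[of k] by (intro ennreal_leI) (simp add: pos_divide_le_eq)
        finally show ?thesis using False by simp
      qed (use p in \<open>simp add: Lp_energy_def\<close>)
    qed auto
    also have "\<dots> = ennreal (2 * (1/2) ^ k)" by (rule sums)
    finally show ?thesis .
  qed

  show ?thesis
    unfolding function_supercyclic_def
  proof (intro bexI[OF _ \<phi>] ballI allI impI)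
    fix u and e :: real assume u: "u \<in> Lp_functions p M" and e: "0 < e"
    then have [measurable]: "u \<in> borel_measurable M" by (simp add: Lp_functions_iff_energy)
    define d where "d = e / (2 * 2 powr p)"
    have d: "0 < d" using e by (simp add: d_def)
    obtain i where i: "Lp_energy p M (\<lambda>x. H i x - u x) < ennreal d"
      using dense[OF u d] by blast
    obtain j where j: "(1/2::real) ^ j < d / 2"
      using real_arch_pow_inv[of "d / 2" "1/2"] d by auto
    \<comment> \<open>Among the repetitions of \<open>H i\<close> one with index at least
      \<open>j\<close> is taken, so that the error \<open>2 * (1/2) ^ k\<close> is below
      \<open>d\<close> while the target stays the same.\<close>
    define k where "k = prod_encode (i, j)"
    have k: "h k = H i" "j \<le> k" by (simp_all add: k_def h_def le_prod_encode_2)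
    have "(1/2::real) ^ k \<le> (1/2) ^ j" using k by (intro power_decreasing) auto
    with j have "2 * (1/2) ^ k < d" by linarith
    then have "ennreal (2 * (1/2) ^ k) < ennreal d" using d by (intro ennreal_lessI)
    with approx[of k] have "Lp_energy p M (\<lambda>x. (1 / a k) * \<phi> ((f ^^ n k) x) - h k x) < ennreal d"
      by (rule le_less_trans)
    moreover have "Lp_energy p M (\<lambda>x. h k x - u x) < ennreal d"
      using i by (simp only: k(1))
    ultimately have "Lp_energy p M (\<lambda>x. (1 / a k) * \<phi> ((f ^^ n k) x) - u x) < ennreal e"
      unfolding d_def by (rule Lp_energy_triangle_less[rotated 4]) (use p e in simp_all)
    then show "\<exists>n c. Lp_energy p M (\<lambda>x. c * \<phi> ((f ^^ n) x) - u x) < ennreal e" by blast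
  qed
qed

theorem function_supercyclic_iff:
  assumes "1 \<le> p"
  shows "function_supercyclic p M f \<longleftrightarrow> (\<forall>\<epsilon>>0. \<exists>n::nat. m (int n) * m (- int n) < \<epsilon>)"
  using function_supercyclic_imp_small_product[OF assms] small_product_imp_function_supercyclic[OF assms]
  by blast

end

section \<open>The composition operator and the shift as instances\<close>

lemma supercyclic_iff_approx:
  assumes "Metric_space E d" and inv: "\<And>n c x. x \<in> E \<Longrightarrow> sm c ((T ^^ n) x) \<in> E"
  shows "supercyclic E d sm T \<longleftrightarrow> (\<exists>x\<in>E. \<forall>z\<in>E. \<forall>r>0. \<exists>n c. d (sm c ((T ^^ n) x)) z < r)"
proof -
  interpret Metric_space E d by fact
  have "mtopology closure_of {sm c ((T ^^ n) x) | n c. True} = E \<longleftrightarrow>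
      (\<forall>z\<in>E. \<forall>r>0. \<exists>n c. d (sm c ((T ^^ n) x)) z < r)" if "x \<in> E" for x
    unfolding metric_closure_of using inv[OF that] by (auto simp: in_mball commute) blast+
  then show ?thesis
    unfolding supercyclic_def by blast
qed

text \<open>Raising to the power \<open>p\<close> is a bijection of the positive reals, so radii of
  balls and bounds on energies can be exchanged.\<close>

lemma powr_radius:
  assumes "1 \<le> (p::real)"
  shows "(\<forall>r>0. P (r powr p)) \<longleftrightarrow> (\<forall>e>0. P e)"
proof (intro iffI allI impI)
  fix e :: real assume *: "\<forall>r>0. P (r powr p)" and e: "0 < e"
  have "P ((e powr (1 / p)) powr p)" using * e by simp
  then show "P e" using assms e by (simp add: powr_powr)
qed simp

context composition_system
begin

lemma funpow_composition_operator_class: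
  assumes "\<phi> \<in> Lp_functions p M"
  shows "(\<lambda>x. \<phi> ((f ^^ n) x)) \<in> Lp_functions p M"
    and "(composition_operator p M f ^^ n) (Lp_rel p M `` {\<phi>}) = Lp_rel p M `` {\<lambda>x. \<phi> ((f ^^ n) x)}"
proof (induction n)
  case (Suc n)
  have *: "(\<lambda>x. \<phi> ((f ^^ Suc n) x)) = (\<lambda>x. \<phi> ((f ^^ n) x)) \<circ> f"
    by (simp add: fun_eq_iff funpow_swap1)
  {
    case 1
    show ?case unfolding * by (rule Lp_functions_comp[OF Suc.IH(1)])
  next
    case 2
    show ?case unfolding * by (simp add: Suc.IH(2) composition_operator_class[OF Suc.IH(1)])
  }
qed (simp_all add: assms)

text \<open>Scaling, iteration and distance of classes can be computed on any representatives, so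
  quantifiers over classes become quantifiers over functions.\<close>

lemma supercyclic_composition_operator_iff:
  assumes p: "1 \<le> p"
  shows "supercyclic (Lp_space p M) (Lp_dist p M) (Lp_scale p M) (composition_operator p M f)
    \<longleftrightarrow> function_supercyclic p M f"
proof -
  let ?cls = "\<lambda>\<phi>. Lp_rel p M `` {\<phi>}"
  have space: "Lp_space p M = ?cls ` Lp_functions p M"
    by (auto simp: Lp_space_def quotient_def)
  have orbit: "Lp_scale p M c ((composition_operator p M f ^^ n) (?cls \<phi>)) = ?cls (\<lambda>x. c * \<phi> ((f ^^ n) x))"
    and orbit_Lp: "(\<lambda>x. c * \<phi> ((f ^^ n) x)) \<in> Lp_functions p M"
    if "\<phi> \<in> Lp_functions p M" for \<phi> n c
    using funpow_composition_operator_class[OF that] by (simp_all add: Lp_scale_class Lp_functions_scale)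
  have dist: "Lp_dist p M (?cls \<phi>) (?cls \<psi>) < r \<longleftrightarrow> Lp_energy p M (\<lambda>x. \<phi> x - \<psi> x) < ennreal (r powr p)"
    if "\<phi> \<in> Lp_functions p M" "\<psi> \<in> Lp_functions p M" "0 < r" for \<phi> \<psi> r
  proof -
    have "Lp_dist p M (?cls \<phi>) (?cls \<psi>) = Lp_norm p M (\<lambda>x. \<phi> x - \<psi> x)"
      using that equiv_class_self[OF equiv_Lp_rel] by (intro Lp_dist_class) (auto simp: space)
    then show ?thesis
      using that p by (simp add: Lp_norm_less_iff_energy Lp_functions_diff)
  qed
  have "supercyclic (Lp_space p M) (Lp_dist p M) (Lp_scale p M) (composition_operator p M f) \<longleftrightarrow>
     (\<exists>x\<in>Lp_space p M. \<forall>z\<in>Lp_space p M. \<forall>r>0. \<exists>n c.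
        Lp_dist p M (Lp_scale p M c ((composition_operator p M f ^^ n) x)) z < r)"
    by (intro supercyclic_iff_approx Metric_space_Lp p) (auto simp: space orbit orbit_Lp)
  also have "\<dots> \<longleftrightarrow> (\<exists>\<phi>\<in>Lp_functions p M. \<forall>u\<in>Lp_functions p M. \<forall>r>0. \<exists>n c.
      Lp_energy p M (\<lambda>x. c * \<phi> ((f ^^ n) x) - u x) < ennreal (r powr p))"
    by (simp add: space orbit orbit_Lp dist cong: bex_cong)
  also have "\<dots> \<longleftrightarrow> function_supercyclic p M f"
    unfolding function_supercyclic_def
    by (subst powr_radius[OF p, where P = "\<lambda>e. \<exists>n c. Lp_energy p M (\<lambda>x. c * _ ((f ^^ n) x) - _ x) < ennreal e"]) simp
  finally show ?thesis .
qed

section \<open>Effect of the map on the measure of sets\<close>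

text \<open>The lower bound for the density is integrated over \<open>A\<close>; integrating the
  density itself gives the push-forward.\<close>

lemma RN_deriv_bounded_below_emeasure:
  assumes "RN_deriv_bounded_below M (distr M M g)" and [measurable]: "g \<in> measurable M M"
  shows "\<exists>c::real. c > 0 \<and> (\<forall>A\<in>sets M. ennreal c * emeasure M A \<le> emeasure M (g -` A \<inter> space M))"
proof -
  obtain h c where h: "h \<in> borel_measurable M" "density M h = distr M M g"
    and c: "(c::real) > 0" "AE x in M. ennreal c \<le> RN_deriv M (distr M M g) x"
    using assms(1) unfolding RN_deriv_bounded_below_def by blast
  have "ennreal c * emeasure M A \<le> emeasure M (g -` A \<inter> space M)" if [measurable]: "A \<in> sets M" for A
  proof -
    have "ennreal c * emeasure M A = (\<integral>\<^sup>+x. ennreal c * indicator A x \<partial>M)"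
      by (simp add: nn_integral_cmult_indicator)
    also have "\<dots> \<le> (\<integral>\<^sup>+x. RN_deriv M (distr M M g) x * indicator A x \<partial>M)"
      using c(2) by (intro nn_integral_mono_AE) (auto elim!: eventually_mono simp: indicator_def)
    also have "\<dots> = emeasure (density M (RN_deriv M (distr M M g))) A"
      by (simp add: emeasure_density)
    also have "\<dots> = emeasure M (g -` A \<inter> space M)"
      unfolding RN_derivI[OF h] by (simp add: emeasure_distr)
    finally show ?thesis .
  qed
  with c show ?thesis by blast
qed

lemma space_UNIV: "space M = UNIV"
  using sets_eq_imp_space_eq[OF sets_borel] by simp

text \<open>The preimage of \<open>A\<close> under \<open>inv f\<close> is its image under
  \<open>f\<close>, which yields the first bound. The second comes from the density for
  \<open>f\<close> evaluated on the image of \<open>A\<close>, whose preimage is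
  \<open>A\<close>.\<close>

lemma emeasure_image_bounds:
  "\<exists>c::real. c > 0 \<and> (\<forall>A\<in>sets M. ennreal c * emeasure M A \<le> emeasure M (f ` A) \<and>
     ennreal c * emeasure M (f ` A) \<le> emeasure M A)"
proof -
  obtain c1 c2 :: real where c: "c1 > 0" "c2 > 0"
    and c1: "\<And>A. A \<in> sets M \<Longrightarrow> ennreal c1 * emeasure M A \<le> emeasure M (inv f -` A \<inter> space M)"
    and c2: "\<And>A. A \<in> sets M \<Longrightarrow> ennreal c2 * emeasure M A \<le> emeasure M (f -` A \<inter> space M)"
    using RN_deriv_bounded_below_emeasure[OF RN_f measurable_inv_f]
      RN_deriv_bounded_below_emeasure[OF RN_inv_f measurable_f] by metis
  have img: "inv f -` A \<inter> space M = f ` A" for A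
    using bij by (simp add: space_UNIV bij_imp_bij_inv bij_vimage_eq_inv_image inv_inv_eq)
  have "f ` A \<in> sets M" if "A \<in> sets M" for A
    using measurable_sets[OF measurable_inv_f that] by (simp only: img)
  note c2 = c2[OF this]
  have "f -` f ` A \<inter> space M = A" for A
    using bij by (simp add: space_UNIV inj_vimage_image_eq bij_is_inj)
  note c2 = c2[unfolded this]
  have min: "ennreal (min c1 c2) * x \<le> ennreal c1 * x" "ennreal (min c1 c2) * x \<le> ennreal c2 * x" for x
    by (auto intro!: mult_right_mono ennreal_leI)
  show ?thesis
  proof (intro exI[of _ "min c1 c2"] conjI ballI)
    fix A assume A: "A \<in> sets M"
    show "ennreal (min c1 c2) * emeasure M A \<le> emeasure M (f ` A)"
      by (rule order_trans[OF min(1) c1[OF A, unfolded img]])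
    show "ennreal (min c1 c2) * emeasure M (f ` A) \<le> emeasure M A"
      by (rule order_trans[OF min(2) c2[OF A]])
  qed (use c in auto)
qed

end

text \<open>The generator is a countable basis of the topology. The two-sided bounds for images
  carry finiteness and positivity of the measure from \<open>W\<close> along its orbit and supply
  \<open>1 / c\<close> as ratio constant.\<close>

lemma (in bounded_distortion_system) wandering: "\<exists>G. wandering_system M f W G"
proof -
  obtain B :: "'a set set" where B: "countable B" "topological_basis B"
    using ex_countable_basis by blast
  have gen: "sets M = sigma_sets UNIV B"
    unfolding sets_borel borel_eq_countable_basis[OF B] by (rule sets_measure_of) simp
  obtain c :: real where c: "c > 0"
    "\<And>A. A \<in> sets M \<Longrightarrow> ennreal c * emeasure M A \<le> emeasure M (f ` A)"
    "\<And>A. A \<in> sets M \<Longrightarrow> ennreal c * emeasure M (f ` A) \<le> emeasure M A"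
    using emeasure_image_bounds by blast
  let ?F = "int_iterate f"
  have sets_F: "?F k ` A \<in> sets M" if "A \<in> sets M" for k A
    using measurable_sets[OF measurable_int_iterate[OF measurable_f measurable_inv_f, of "- k"] that]
    by (simp add: int_iterate_image_eq_vimage[OF bij] space_UNIV)
  have F_Suc: "?F (k + 1) ` A = f ` ?F k ` A" for k A
    by (simp add: int_iterate_add1[OF bij] image_comp)
  have fin_iff: "emeasure M (f ` A) < \<infinity> \<longleftrightarrow> emeasure M A < \<infinity>" if "A \<in> sets M" for A
    using c(2,3)[OF that] c(1) by (auto simp: ennreal_mult_less_top less_top[symmetric] top_unique ennreal_mult_eq_top_iff)
  have null_iff: "emeasure M (f ` A) = 0 \<longleftrightarrow> emeasure M A = 0" if "A \<in> sets M" for A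
    using c(2,3)[OF that] c(1) by auto
  have fin: "emeasure M (?F k ` A) < \<infinity> \<longleftrightarrow> emeasure M A < \<infinity>" if "A \<in> sets M" for A k
  proof (induction k rule: int_induct[where k = 0])
    case (step1 i)
    then show ?case using F_Suc[of i A] fin_iff[OF sets_F[OF that], of i] by simp
  next
    case (step2 i)
    then show ?case using F_Suc[of "i - 1" A] fin_iff[OF sets_F[OF that], of "i - 1"] by simp
  qed simp
  have null: "emeasure M (?F k ` A) = 0 \<longleftrightarrow> emeasure M A = 0" if "A \<in> sets M" for A k
  proof (induction k rule: int_induct[where k = 0])
    case (step2 i)
    then show ?case using F_Suc[of "i - 1" A] null_iff[OF sets_F[OF that], of "i - 1"] by simp
  qed (simp_all add: F_Suc null_iff sets_F that)
  have em: "emeasure M (?F k ` A) = ennreal (measure M (?F k ` A))" if "A \<in> sets M" "A \<subseteq> W" for A k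
  proof -
    have "emeasure M A \<le> emeasure M W" using that W_sets by (intro emeasure_mono) auto
    then have "emeasure M A < \<infinity>" using W_finite by (rule le_less_trans)
    then have "emeasure M (?F k ` A) < \<infinity>" using fin[OF that(1)] by simp
    then show ?thesis by (intro emeasure_eq_ennreal_measure) auto
  qed
  have "wandering_system M f W B"
  proof
    show "emeasure M (?F k ` W) < \<infinity>" for k
      using fin[OF W_sets] W_finite by simp
    show "0 < emeasure M (?F k ` W)" for k
      using null[OF W_sets, of k] W_pos by (simp add: zero_less_iff_neq_zero)
    show "\<exists>C. \<forall>k. measure M (?F (k + 1) ` W) \<le> C * measure M (?F k ` W) \<and>
        measure M (?F k ` W) \<le> C * measure M (?F (k + 1) ` W)"
    proof (intro exI[of _ "1 / c"] allI)
      fix k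
      have "ennreal c * emeasure M (?F k ` W) \<le> emeasure M (?F (k + 1) ` W)"
        "ennreal c * emeasure M (?F (k + 1) ` W) \<le> emeasure M (?F k ` W)"
        unfolding F_Suc by (rule c(2,3)[OF sets_F[OF W_sets]])+
      then have "c * measure M (?F k ` W) \<le> measure M (?F (k + 1) ` W)"
        "c * measure M (?F (k + 1) ` W) \<le> measure M (?F k ` W)"
        using c(1) by (simp_all add: em W_sets ennreal_mult[symmetric])
      then show "measure M (?F (k + 1) ` W) \<le> 1 / c * measure M (?F k ` W) \<and>
          measure M (?F k ` W) \<le> 1 / c * measure M (?F (k + 1) ` W)"
        using c(1) by (simp add: field_simps)
    qed
    obtain K :: real where K: "K > 0" and dist: "\<And>k B. B \<in> sets M \<Longrightarrow> B \<subseteq> W \<Longrightarrow> emeasure M B > 0 \<Longrightarrow>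
          ennreal (1 / K) * emeasure M (?F k ` W) * emeasure M B \<le> emeasure M (?F k ` B) * emeasure M W \<and>
          emeasure M (?F k ` B) * emeasure M W \<le> ennreal K * emeasure M (?F k ` W) * emeasure M B"
      using distortion by blast
    show "\<exists>K::real. \<forall>k. \<forall>B\<in>sets M. B \<subseteq> W \<longrightarrow>
        measure M (?F k ` W) * measure M B \<le> K * (measure M (?F k ` B) * measure M W) \<and>
        measure M (?F k ` B) * measure M W \<le> K * (measure M (?F k ` W) * measure M B)"
    proof (intro exI[of _ K] allI ballI impI)
      fix k B assume B: "B \<in> sets M" "B \<subseteq> W"
      show "measure M (?F k ` W) * measure M B \<le> K * (measure M (?F k ` B) * measure M W) \<and>
        measure M (?F k ` B) * measure M W \<le> K * (measure M (?F k ` W) * measure M B)"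
      proof (cases "emeasure M B = 0")
        case True
        \<comment> \<open>The distortion hypothesis speaks of sets of positive measure. Images of
          null sets are null, so here both inequalities read \<open>0 \<le> 0\<close>.\<close>
        with null[OF B(1), of k] show ?thesis by (simp add: measure_def)
      next
        case False
        then have "emeasure M B > 0" by (simp add: zero_less_iff_neq_zero)
        from dist[OF B this, of k] have
          "1 / K * measure M (?F k ` W) * measure M B \<le> measure M (?F k ` B) * measure M W"
          "measure M (?F k ` B) * measure M W \<le> K * measure M (?F k ` W) * measure M B"
          using em[OF B] em[OF W_sets] em[OF B, of 0] em[OF W_sets order_refl, of 0] K W_sets
          by (simp_all add: ennreal_mult[symmetric])
        then show ?thesis using K by (simp add: field_simps)
      qed
    qed
  qed (use bij measurable_f measurable_inv_f B gen W_sets W_cover W_disjoint in auto)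
  then show ?thesis by blast
qed

section \<open>The weighted shift as a translation of the integers\<close>

definition weighted_counting :: "(int \<Rightarrow> real) \<Rightarrow> int measure" where
  "weighted_counting m = density (count_space UNIV) (\<lambda>k. ennreal (m k))"

lemma sets_weighted_counting [simp]: "sets (weighted_counting m) = UNIV"
  and space_weighted_counting [simp]: "space (weighted_counting m) = UNIV"
  by (simp_all add: weighted_counting_def)

lemma measurable_weighted_counting [simp]:
  "g \<in> measurable (weighted_counting m) N \<longleftrightarrow> g \<in> UNIV \<rightarrow> space N"
  by (auto simp: measurable_def)

lemma bij_translation: "bij (\<lambda>i::int. i + 1)"
  by (rule bij_betw_byWitness[where f' = "\<lambda>i. i - 1"]) auto

lemma int_iterate_translation: "int_iterate (\<lambda>i::int. i + 1) k = (\<lambda>i. i + k)"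
proof (induction k rule: int_induct[where k = 0])
  case (step1 i)
  then show ?case
    by (simp add: int_iterate_add1[OF bij_translation] fun_eq_iff)
next
  case (step2 i)
  then show ?case
    using int_iterate_add1[OF bij_translation, of "i - 1"] by (auto simp: fun_eq_iff algebra_simps)
qed (simp add: fun_eq_iff)

lemma funpow_translation: "((\<lambda>i::int. i + 1) ^^ n) i = i + int n"
  using int_iterate_translation[of "int n"] by (simp add: int_iterate_of_nat)

lemma emeasure_weighted_counting_singleton: "emeasure (weighted_counting m) {k} = ennreal (m k)"
proof -
  have "emeasure (weighted_counting m) {k} = (\<integral>\<^sup>+i. ennreal (m i) * indicator {k} i \<partial>count_space UNIV)"
    by (simp add: weighted_counting_def emeasure_density)
  also have "\<dots> = ennreal (m k)"
    by (subst nn_integral_indicator_singleton) auto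
  finally show ?thesis .
qed

text \<open>The orbit of \<open>{0}\<close> consists of the singletons. Distortion holds with
  constant 1, since the only subsets of \<open>{0}\<close> are the empty set and
  \<open>{0}\<close>.\<close>

lemma wandering_weighted_counting:
  assumes m: "\<And>k. 0 < m k" and C: "\<And>k. m (k + 1) \<le> C * m k" "\<And>k. m k \<le> C * m (k + 1)"
  shows "wandering_system (weighted_counting m) (\<lambda>i. i + 1) {0} (range (\<lambda>i. {i}))"
proof
  note [simp] = int_iterate_translation emeasure_weighted_counting_singleton
  have [simp]: "measure (weighted_counting m) {k} = m k" for k
    using m[of k] by (simp add: measure_def)
  show "bij (\<lambda>i::int. i + 1)" by (rule bij_translation)
  show "sets (weighted_counting m) = sigma_sets UNIV (range (\<lambda>i. {i}))"
  proof -
    have "A \<in> sigma_sets UNIV (range (\<lambda>i. {i}))" for A :: "int set"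
    proof -
      have "(\<Union>i\<in>A. {i}) \<in> sigma_sets UNIV (range (\<lambda>i. {i}))"
        by (rule sigma_sets_UNION) (auto intro: sigma_sets.Basic)
      then show ?thesis by simp
    qed
    then show ?thesis by auto
  qed
  show "disjoint_family (\<lambda>k. int_iterate (\<lambda>i::int. i + 1) k ` {0})"
    by (simp add: disjoint_family_on_def)
  show "\<exists>C. \<forall>k. measure (weighted_counting m) (int_iterate (\<lambda>i. i + 1) (k + 1) ` {0}) \<le>
      C * measure (weighted_counting m) (int_iterate (\<lambda>i. i + 1) k ` {0}) \<and>
      measure (weighted_counting m) (int_iterate (\<lambda>i. i + 1) k ` {0}) \<le>
      C * measure (weighted_counting m) (int_iterate (\<lambda>i. i + 1) (k + 1) ` {0})"
    using C by auto
  show "\<exists>K. \<forall>k. \<forall>B\<in>sets (weighted_counting m). B \<subseteq> {0} \<longrightarrow>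
      measure (weighted_counting m) (int_iterate (\<lambda>i. i + 1) k ` {0}) * measure (weighted_counting m) B
        \<le> K * (measure (weighted_counting m) (int_iterate (\<lambda>i. i + 1) k ` B) * measure (weighted_counting m) {0}) \<and>
      measure (weighted_counting m) (int_iterate (\<lambda>i. i + 1) k ` B) * measure (weighted_counting m) {0}
        \<le> K * (measure (weighted_counting m) (int_iterate (\<lambda>i. i + 1) k ` {0}) * measure (weighted_counting m) B)"
    by (intro exI[of _ 1]) (auto simp: subset_singleton_iff)
qed (use m in \<open>auto simp: int_iterate_translation emeasure_weighted_counting_singleton\<close>)

text \<open>The root of the weight moves from the measure into the function; this is the isometry
  that turns translation into the shift.\<close>

lemma Lp_energy_weighted_counting:
  assumes "1 \<le> p" "\<And>k. 0 < m k"
  shows "Lp_energy p (weighted_counting m) \<phi> =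
    Lp_energy p (count_space UNIV) (\<lambda>k. complex_of_real (m k powr (1 / p)) * \<phi> k)"
  using assms unfolding Lp_energy_def weighted_counting_def
  by (subst nn_integral_density)
     (auto simp: norm_mult powr_mult powr_powr less_imp_le ennreal_mult intro!: nn_integral_cong)

lemma lp_space_iff_energy: "x \<in> lp_space p \<longleftrightarrow> Lp_energy p (count_space UNIV) x < \<infinity>"
  by (simp add: lp_space_eq Lp_functions_iff_energy)

lemma lp_dist_less_iff_energy:
  assumes "1 \<le> p" "x \<in> lp_space p" "y \<in> lp_space p" "0 < r"
  shows "lp_dist p x y < r \<longleftrightarrow> Lp_energy p (count_space UNIV) (\<lambda>i. x i - y i) < ennreal (r powr p)"
  unfolding lp_dist_eq[OF assms(1-3)] using assms
  by (intro Lp_norm_less_iff_energy Lp_functions_diff) (simp_all add: lp_space_eq)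

text \<open>With \<open>\<beta> k = m k powr (1 / p)\<close> the weights satisfy
  \<open>w (k + 1) * \<beta> (k + 1) = \<beta> k\<close>. Hence multiplication by
  \<open>\<beta>\<close> intertwines composition with the translation and the backward
  shift.\<close>

lemma supercyclic_weighted_shift_iff:
  assumes p: "1 \<le> p" and m: "\<And>k. 0 < m k" and C: "\<And>k. m k \<le> C * m (k + 1)"
    and w: "\<And>k. w k = (m (k - 1) / m k) powr (1 / p)"
  shows "supercyclic (lp_space p) (lp_dist p) lp_scale (weighted_shift (\<lambda>k. of_real (w k)))
    \<longleftrightarrow> function_supercyclic p (weighted_counting m) (\<lambda>i. i + 1)"
proof -
  define \<beta> where "\<beta> k = complex_of_real (m k powr (1 / p))" for k
  define B where "B = weighted_shift (\<lambda>k. complex_of_real (w k))"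
  let ?E = "Lp_energy p (count_space UNIV)" and ?N = "weighted_counting m"
  have \<beta>: "\<beta> k \<noteq> 0" for k using m[of k] by (simp add: \<beta>_def)
  have w\<beta>: "complex_of_real (w (k + 1)) * \<beta> (k + 1) = \<beta> k" for k
    using m[of k] m[of "k + 1"] by (simp add: w \<beta>_def powr_divide)
  \<comment> \<open>The ratio bound makes the weights bounded, which is why the shift maps the
    sequence space into itself.\<close>
  have w_le: "norm (complex_of_real (w (k + 1))) \<le> C powr (1 / p)" for k
    using C[of k] m[of k] m[of "k + 1"] p by (auto simp: w pos_divide_le_eq intro!: powr_mono2)
  have lp_B: "B x \<in> lp_space p" if "x \<in> lp_space p" for x
  proof -
    have "?E (B x) \<le> ?E (\<lambda>i. complex_of_real (C powr (1 / p)) * x (i + 1))"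
      using p w_le by (intro Lp_energy_mono) (auto simp: B_def weighted_shift_def norm_mult intro!: mult_right_mono)
    also have "\<dots> = ennreal (norm (complex_of_real (C powr (1 / p))) powr p) * ?E (\<lambda>i. x (i + 1))"
      by (rule Lp_energy_scale) simp
    also have "?E (\<lambda>i. x (i + 1)) = ?E x"
      unfolding Lp_energy_def
      by (rule nn_integral_bij_count_space[OF bij_translation, where f = "\<lambda>i. ennreal (norm (x i) powr p)"])
    finally show ?thesis
      using that by (auto simp: lp_space_iff_energy ennreal_mult_less_top intro: le_less_trans)
  qed
  have lp_orbit: "lp_scale c ((B ^^ n) x) \<in> lp_space p" if "x \<in> lp_space p" for c n x
  proof -
    have "(B ^^ n) x \<in> lp_space p" using that by (induction n) (auto intro: lp_B)
    then show ?thesis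
      using Lp_functions_scale by (auto simp: lp_space_eq lp_scale_def)
  qed
  have orbit: "(B ^^ n) (\<lambda>i. \<beta> i * \<phi> i) = (\<lambda>i. \<beta> i * \<phi> (i + int n))" for n \<phi>
  proof (induction n)
    case (Suc n)
    have w\<beta>': "complex_of_real (w (i + 1)) * (\<beta> (i + 1) * z) = \<beta> i * z" for i z
      using w\<beta>[of i] by (metis mult.assoc)
    have "B (\<lambda>i. \<beta> i * \<phi> (i + int n)) = (\<lambda>i. \<beta> i * \<phi> (i + int (Suc n)))"
      unfolding B_def weighted_shift_def w\<beta>' by (simp add: add_ac)
    then show ?case by (simp add: Suc)
  qed simp
  have space: "lp_space p = (\<lambda>\<phi> i. \<beta> i * \<phi> i) ` Lp_functions p ?N"
  proof -
    have iff: "x \<in> lp_space p \<longleftrightarrow> (\<lambda>i. x i / \<beta> i) \<in> Lp_functions p ?N" for x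
      using \<beta> by (simp add: lp_space_iff_energy Lp_functions_iff_energy Lp_energy_weighted_counting[OF p m] \<beta>_def[symmetric])
    show ?thesis
    proof (intro equalityI subsetI)
      fix x assume "x \<in> lp_space p"
      then show "x \<in> (\<lambda>\<phi> i. \<beta> i * \<phi> i) ` Lp_functions p ?N"
        using \<beta> by (intro image_eqI[of _ _ "\<lambda>i. x i / \<beta> i"]) (simp_all add: iff)
    next
      fix x assume "x \<in> (\<lambda>\<phi> i. \<beta> i * \<phi> i) ` Lp_functions p ?N"
      then obtain \<phi> where "\<phi> \<in> Lp_functions p ?N" "x = (\<lambda>i. \<beta> i * \<phi> i)" by blast
      then show "x \<in> lp_space p"
        using \<beta> by (simp add: iff)
    qed
  qed
  have dist: "lp_dist p (lp_scale c ((B ^^ n) (\<lambda>i. \<beta> i * \<phi> i))) (\<lambda>i. \<beta> i * u i) < r \<longleftrightarrow>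
      Lp_energy p ?N (\<lambda>i. c * \<phi> (((\<lambda>i. i + 1) ^^ n) i) - u i) < ennreal (r powr p)"
    if "\<phi> \<in> Lp_functions p ?N" "u \<in> Lp_functions p ?N" "0 < r" for \<phi> u c n r
  proof -
    have "lp_dist p (lp_scale c ((B ^^ n) (\<lambda>i. \<beta> i * \<phi> i))) (\<lambda>i. \<beta> i * u i) < r \<longleftrightarrow>
        ?E (\<lambda>i. lp_scale c ((B ^^ n) (\<lambda>i. \<beta> i * \<phi> i)) i - \<beta> i * u i) < ennreal (r powr p)"
      using that p by (intro lp_dist_less_iff_energy lp_orbit) (auto simp: space)
    also have "(\<lambda>i. lp_scale c ((B ^^ n) (\<lambda>i. \<beta> i * \<phi> i)) i - \<beta> i * u i) =
        (\<lambda>i. \<beta> i * (c * \<phi> (((\<lambda>i. i + 1) ^^ n) i) - u i))"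
      by (simp add: orbit lp_scale_def funpow_translation fun_eq_iff algebra_simps)
    finally show ?thesis
      by (simp add: Lp_energy_weighted_counting[OF p m] \<beta>_def)
  qed
  have "supercyclic (lp_space p) (lp_dist p) lp_scale B \<longleftrightarrow>
     (\<exists>x\<in>lp_space p. \<forall>z\<in>lp_space p. \<forall>r>0. \<exists>n c. lp_dist p (lp_scale c ((B ^^ n) x)) z < r)"
    by (intro supercyclic_iff_approx Metric_space_lp p lp_orbit)
  also have "\<dots> \<longleftrightarrow> (\<exists>\<phi>\<in>Lp_functions p ?N. \<forall>u\<in>Lp_functions p ?N. \<forall>r>0. \<exists>n c.
      Lp_energy p ?N (\<lambda>i. c * \<phi> (((\<lambda>i. i + 1) ^^ n) i) - u i) < ennreal (r powr p))"
    unfolding space by (simp add: dist cong: bex_cong)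
  also have "\<dots> \<longleftrightarrow> function_supercyclic p ?N (\<lambda>i. i + 1)"
    unfolding function_supercyclic_def
    by (subst powr_radius[OF p, where P = "\<lambda>e. \<exists>n c. Lp_energy p ?N (\<lambda>x. c * _ (((\<lambda>i. i + 1) ^^ n) x) - _ x) < ennreal e"]) simp
  finally show ?thesis
    by (simp add: B_def)
qed

theorem corollary4p6:
  fixes p :: real
    and M :: "'a::{second_countable_topology, t2_space} measure"
    and f :: "'a \<Rightarrow> 'a" and W :: "'a set" and w :: "int \<Rightarrow> real"
  assumes "1 \<le> p"
    and "bounded_distortion_system M f W"
    and "\<And>k. w k = (measure M (int_iterate f (k - 1) ` W) / measure M (int_iterate f k ` W)) powr (1 / p)"
  shows "supercyclic (Lp_space p M) (Lp_dist p M) (Lp_scale p M) (composition_operator p M f) \<longleftrightarrow>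
         supercyclic (lp_space p) (lp_dist p) lp_scale (weighted_shift (\<lambda>k. of_real (w k)))"
proof -
  interpret bounded_distortion_system M f W by fact
  obtain G where "wandering_system M f W G" using wandering by blast
  then interpret X: wandering_system M f W G .
  define m where "m = X.m"
  have m: "0 < m k" for k by (simp add: m_def X.m_pos)
  obtain C where C: "m (k + 1) \<le> C * m k" "m k \<le> C * m (k + 1)" for k
    using X.ratio by (auto simp: m_def X.m_def)
  interpret Z: wandering_system "weighted_counting m" "\<lambda>i. i + 1" "{0}" "range (\<lambda>i. {i})"
    by (rule wandering_weighted_counting[where m = m and C = C]) (rule m C)+
  \<comment> \<open>Both systems have the same numbers \<open>m k\<close>, and the criterion
    involves nothing else.\<close>
  have "Z.m k = m k" for k
    using m[of k] by (simp add: Z.m_def int_iterate_translation measure_def emeasure_weighted_counting_singleton)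
  then have "function_supercyclic p M f \<longleftrightarrow> function_supercyclic p (weighted_counting m) (\<lambda>i. i + 1)"
    using X.function_supercyclic_iff[OF assms(1)] Z.function_supercyclic_iff[OF assms(1)]
    by (simp add: m_def)
  moreover have "w k = (m (k - 1) / m k) powr (1 / p)" for k
    by (simp add: assms(3) m_def X.m_def)
  ultimately show ?thesis
    using supercyclic_composition_operator_iff[OF assms(1)]
      supercyclic_weighted_shift_iff[where m = m and C = C and w = w, OF assms(1) m C(2)] by blast
qed

end
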